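(* For every positive integer $n$, $\theta(K_{n,n,n}\times K_2)=\lceil (n+1)/2\rceil$.
   Context: The thickness $\theta(G)$ of a graph $G$ is the minimum number of planar subgraphs whose union is $G$. The Kronecker product $G\times H$ of graphs $G$ and $H$ is the graph with vertex set $V(G)\times V(H)$ in which $(g,h)$ and $(g',h')$ are adjacent if and only if $gg'\in E(G)$ and $hh'\in E(H)$. $K_{n,n,n}$ denotes the complete tripartite graph with three parts of size $n$. *)

theory Defs
  imports "HOL-Analysis.Analysis"
begin

type_synonym 'a ugraph = "'a set \<times> 'a set set"

definition simple_graph :: "'a ugraph \<Rightarrow> bool" where
  "simple_graph G \<longleftrightarrow> finite (fst G) \<and> (\<forall>e\<in>snd G. e \<subseteq> fst G \<and> card e = 2)"

definition planar :: "'a ugraph \<Rightarrow> bool" where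
  "planar G \<longleftrightarrow> (\<exists>(pos :: 'a \<Rightarrow> complex) (c :: 'a set \<Rightarrow> real \<Rightarrow> complex).
     inj_on pos (fst G) \<and>
     (\<forall>e\<in>snd G. arc (c e) \<and> {pathstart (c e), pathfinish (c e)} = pos ` e \<and>
                 path_image (c e) \<inter> pos ` fst G = pos ` e) \<and>
     (\<forall>e\<in>snd G. \<forall>e'\<in>snd G. e \<noteq> e' \<longrightarrow> path_image (c e) \<inter> path_image (c e') \<subseteq> pos ` (e \<inter> e')))"

definition thickness :: "'a ugraph \<Rightarrow> nat" where
  "thickness G = (LEAST k. \<exists>F :: nat \<Rightarrow> 'a set set.
      (\<forall>i<k. F i \<subseteq> snd G \<and> planar (fst G, F i)) \<and> (\<Union>i<k. F i) = snd G)"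

definition kron :: "'a ugraph \<Rightarrow> 'b ugraph \<Rightarrow> ('a \<times> 'b) ugraph" where
  "kron G H = (fst G \<times> fst H,
     {{(g, h), (g', h')} | g h g' h'. {g, g'} \<in> snd G \<and> {h, h'} \<in> snd H})"

definition K_nnn :: "nat \<Rightarrow> (nat \<times> nat) ugraph" where
  "K_nnn n = ({0..<3} \<times> {0..<n},
     {{(i, a), (j, b)} | i a j b. i < 3 \<and> j < 3 \<and> a < n \<and> b < n \<and> i \<noteq> j})"

definition K2 :: "nat ugraph" where
  "K2 = ({0, 1}, {{0, 1}})"

end

theory Submission
  imports Defs
begin

text \<open>
  Lower bound: in a plane bipartite graph every edge lies on the boundary of at most two faces
  (Janiszewski's theorem) and every face has at least four edges on its boundary (a forest does not
  separate the plane), while the Jordan curve theorem shows that every edge closing a cycle creates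
  a new face. Hence such a graph on \<open>v\<close> vertices has at most \<open>2 v - 2\<close> edges, and \<open>k\<close> planar layers
  cover at most \<open>k (12 n - 2)\<close> of the \<open>6 n\<^sup>2\<close> edges, which forces \<open>2 k > n\<close>.

  Upper bound: the graph is a 6-cycle with each vertex blown up to \<open>n\<close> copies. Pair the copies as
  \<open>{2 r, 2 r + 1}\<close>. Layer \<open>r\<close> joins all copies of \<open>q\<close> to the \<open>r\<close>-th pair of copies of \<open>q + 1\<close>, except
  for one edge inside the pair; it is an antiprism whose diagonals are replaced by bundles of paths.
  The exceptional edges and the edges to the unpaired copies (\<open>n\<close> odd) go to one additional layer,
  a hexagon with bundles of paths parallel to its edges. All layers have two-page book embeddings.
\<close>

subsection \<open>Faces of the complement of an arc and a closed set\<close>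

text \<open>Only inner points of the arc count: a face may reach an end vertex through other edges
  without having this edge on its boundary.\<close>

definition touches :: "complex set \<Rightarrow> (real \<Rightarrow> complex) \<Rightarrow> bool" where
  "touches U g \<longleftrightarrow> frontier U \<inter> (path_image g - {pathstart g, pathfinish g}) \<noteq> {}"

text \<open>The frontier points of \<open>U\<close> on the open arc can be added to \<open>U\<close>
  because the result lies between \<open>U\<close> and its closure; they are the overlap with the
  connected open arc.\<close>

lemma connected_Un_touched_arc:
  assumes "arc g" "connected U" "touches U g"
  shows "connected (U \<union> (path_image g - {pathstart g, pathfinish g}))"
proof -
  let ?I = "path_image g - {pathstart g, pathfinish g}"
  have I: "connected ?I"
    using assms(1) by (simp add: arc_imp_simple_path connected_simple_path_endless)
  have "connected (U \<union> (?I \<inter> frontier U))"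
    by (rule connected_intermediate_closure[OF assms(2)]) (auto simp: closure_Un_frontier)
  then have "connected ((U \<union> (?I \<inter> frontier U)) \<union> ?I)"
    using assms(3) I by (rule_tac connected_Un) (auto simp: touches_def)
  moreover have "(U \<union> (?I \<inter> frontier U)) \<union> ?I = U \<union> ?I" by blast
  ultimately show ?thesis by simp
qed

text \<open>The inner part of \<open>g\<close> avoids \<open>X\<close>, so it serves as a bridge:
  faces that touch \<open>g\<close> are merged when \<open>g\<close> is erased.\<close>

lemma touching_components_connected:
  fixes X :: "complex set"
  assumes g: "arc g" "path_image g \<inter> X = {pathstart g, pathfinish g}"
    and U: "U \<in> components (- (X \<union> path_image g))" "touches U g"
    and W: "W \<in> components (- (X \<union> path_image g))" "touches W g"
    and "a \<in> U" "b \<in> W"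
  shows "connected_component (- X) a b"
proof -
  let ?I = "path_image g - {pathstart g, pathfinish g}"
  have "connected (U \<union> ?I)" "connected (W \<union> ?I)"
    using connected_Un_touched_arc g(1) U W in_components_connected by blast+
  then have "connected ((U \<union> ?I) \<union> (W \<union> ?I))"
    using U(2) by (rule_tac connected_Un) (auto simp: touches_def)
  moreover have "(U \<union> ?I) \<union> (W \<union> ?I) \<subseteq> - X"
    using in_components_subset[OF U(1)] in_components_subset[OF W(1)] g(2) by blast
  ultimately show ?thesis
    using assms(7,8) unfolding connected_component_def by blast
qed

text \<open>The frontier of \<open>U\<close> lies in \<open>X\<close> alone, so the face of
  \<open>X\<close> around \<open>U\<close> cannot extend beyond \<open>U\<close> without meeting
  that frontier.\<close>

lemma untouched_component:
  fixes X :: "complex set"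
  assumes X: "closed X" and g: "arc g" "path_image g \<inter> X = {pathstart g, pathfinish g}"
    and U: "U \<in> components (- (X \<union> path_image g))" "\<not> touches U g"
  shows "U \<in> components (- X)"
proof -
  have "closed (X \<union> path_image g)"
    using X g by (simp add: closed_Un closed_arc_image)
  then have "frontier U \<subseteq> X \<union> path_image g"
    using U(1) by (rule frontier_of_components_closed_complement)
  then have fr: "frontier U \<subseteq> X"
    using U(2) g(2) unfolding touches_def by blast
  obtain W where W: "W \<in> components (- X)" "U \<subseteq> W"
    using exists_component_superset[of U "- X"] in_components_connected[OF U(1)]
      in_components_nonempty[OF U(1)] in_components_subset[OF U(1)] by auto
  have "U = W"
  proof (rule ccontr)
    assume "U \<noteq> W"
    then have "W \<inter> frontier U \<noteq> {}"
      using W in_components_connected[OF W(1)] in_components_nonempty[OF U(1)]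
      by (intro connected_Int_frontier) auto
    then show False
      using fr in_components_subset[OF W(1)] by blast
  qed
  with W show ?thesis by simp
qed

lemma loop_from_arcs:
  fixes g h :: "real \<Rightarrow> complex"
  assumes g: "arc g" "path_image g \<inter> X = {pathstart g, pathfinish g}"
    and h: "arc h" "path_image h \<subseteq> X" "pathstart h = pathfinish g" "pathfinish h = pathstart g"
  shows "simple_path (g +++ h)" "pathfinish (g +++ h) = pathstart (g +++ h)"
    "path_image (g +++ h) = path_image g \<union> path_image h"
  using assms by (auto intro!: simple_path_join_loop simp: path_image_join)

text \<open>The arcs \<open>g\<close> and \<open>h\<close> form a Jordan curve \<open>C\<close>. Two
  touching faces on the same side of \<open>C\<close> are separated neither by \<open>C\<close> nor
  by \<open>X\<close>, and \<open>C \<inter> X\<close> is the connected image of \<open>h\<close>.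
  By Janiszewski's theorem they coincide, which leaves at most one face per side.\<close>

lemma touching_components_cycle:
  fixes X :: "complex set"
  assumes X: "closed X" and g: "arc g" "path_image g \<inter> X = {pathstart g, pathfinish g}"
    and h: "arc h" "path_image h \<subseteq> X" "pathstart h = pathfinish g" "pathfinish h = pathstart g"
  shows "finite {U \<in> components (- (X \<union> path_image g)). touches U g} \<and>
         card {U \<in> components (- (X \<union> path_image g)). touches U g} \<le> 2"
proof -
  define C where "C = path_image (g +++ h)"
  note loop = loop_from_arcs[OF g h]
  note J = Jordan_inside_outside[OF loop(1,2), folded C_def]
  let ?S = "{U \<in> components (- (X \<union> path_image g)). touches U g}"
  have CX: "C \<subseteq> X \<union> path_image g" and C_Un: "C \<union> X = X \<union> path_image g"
    using loop(3) h(2) unfolding C_def by auto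
  have "C \<inter> X = path_image h"
  proof -
    have "pathstart h \<in> path_image h" "pathfinish h \<in> path_image h" by auto
    then have "path_image g \<inter> X \<subseteq> path_image h"
      using g(2) h by simp
    with h(2) loop(3) show ?thesis unfolding C_def by blast
  qed
  then have conn: "connected (C \<inter> X)"
    using h(1) by (simp add: connected_arc_image)
  have compC: "compact C"
    unfolding C_def using loop(1) by (simp add: compact_simple_path_image)
  have same: "U = W" if UW: "U \<in> ?S" "W \<in> ?S" and D: "D \<in> {inside C, outside C}" "U \<subseteq> D" "W \<subseteq> D" for U W D
  proof -
    obtain a b where ab: "a \<in> U" "b \<in> W"
      using UW in_components_nonempty by blast
    have "connected D" "D \<subseteq> - C"
      using D(1) J by blast+
    then have "connected_component (- C) a b"
      using D ab unfolding connected_component_def by blast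
    moreover have "connected_component (- X) a b"
      using touching_components_connected[OF g] UW ab by blast
    ultimately have "connected_component (- (C \<union> X)) a b"
      using Janiszewski compC X conn by blast
    then have "connected_component (- (X \<union> path_image g)) a b"
      by (simp add: C_Un)
    then show "U = W"
      using UW ab joinable_components_eq[of _ "- (X \<union> path_image g)" U W]
      unfolding connected_component_def by blast
  qed
  have side: "U \<subseteq> inside C \<or> U \<subseteq> outside C" if "U \<in> ?S" for U
  proof -
    have "connected U" "U \<subseteq> inside C \<union> outside C"
      using that in_components_connected in_components_subset[of U] CX J by blast+
    moreover from this have "inside C \<inter> U = {} \<or> outside C \<inter> U = {}"
      using J by (intro connectedD) auto
    ultimately show ?thesis by blast
  qed
  have "inj_on (\<lambda>U. U \<subseteq> inside C) ?S"
  proof (rule inj_onI)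
    fix U W assume UW: "U \<in> ?S" "W \<in> ?S" "(U \<subseteq> inside C) = (W \<subseteq> inside C)"
    then show "U = W"
      using same[OF UW(1,2), of "inside C"] same[OF UW(1,2), of "outside C"] side[OF UW(1)] side[OF UW(2)]
      by blast
  qed
  moreover have "(\<lambda>U. U \<subseteq> inside C) ` ?S \<subseteq> (UNIV :: bool set)" by simp
  ultimately show ?thesis
    using card_inj_on_le[of "\<lambda>U. U \<subseteq> inside C" ?S UNIV] inj_on_finite[of "\<lambda>U. U \<subseteq> inside C" ?S UNIV]
    by (simp add: card_UNIV_bool)
qed

text \<open>Here \<open>g\<close> meets \<open>A\<close> in one point, and \<open>g\<close> together
  with \<open>A\<close> meets \<open>B\<close> in one point. Two applications of Janiszewski's
  theorem show that only one face can touch \<open>g\<close>; the bound 2 matches the cycle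
  case.\<close>

lemma touching_components_bridge:
  fixes X :: "complex set"
  assumes g: "arc g" "path_image g \<inter> X = {pathstart g, pathfinish g}"
    and AB: "closed A" "compact B" "X = A \<union> B" "A \<inter> B = {}" "pathstart g \<in> A" "pathfinish g \<in> B"
  shows "finite {U \<in> components (- (X \<union> path_image g)). touches U g} \<and>
         card {U \<in> components (- (X \<union> path_image g)). touches U g} \<le> 2"
proof -
  let ?S = "{U \<in> components (- (X \<union> path_image g)). touches U g}"
  have cg: "compact (path_image g)"
    using g(1) by (simp add: compact_arc_image)
  have same: "U = W" if UW: "U \<in> ?S" "W \<in> ?S" for U W
  proof -
    obtain a b where ab: "a \<in> U" "b \<in> W"
      using UW in_components_nonempty by blast
    have notin: "a \<notin> path_image g" "b \<notin> path_image g"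
      using ab UW in_components_subset by blast+
    have "connected_component (- X) a b"
      using touching_components_connected[OF g] UW ab by blast
    then have cA: "connected_component (- A) a b" and cB: "connected_component (- B) a b"
      using AB(3) by (auto elim: connected_component_of_subset)
    have "connected (- path_image g)"
      using g(1) by (simp add: connected_arc_complement)
    then have cgab: "connected_component (- path_image g) a b"
      using notin by (auto intro: connected_componentI)
    have "path_image g \<inter> A = {pathstart g}" "path_image g \<inter> B = {pathfinish g}"
      using g(2) AB by auto
    moreover from this have "(path_image g \<union> A) \<inter> B = {pathfinish g}"
      using AB by auto
    ultimately have cgA: "connected_component (- (path_image g \<union> A)) a b"
      using Janiszewski[OF cg AB(1) _ cgab cA] by simp
    have "connected_component (- (B \<union> (path_image g \<union> A))) a b"
      using Janiszewski[OF AB(2) _ _ cB cgA] AB cg \<open>(path_image g \<union> A) \<inter> B = _\<close>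
      by (simp add: Int_commute closed_Un compact_imp_closed)
    moreover have "B \<union> (path_image g \<union> A) = X \<union> path_image g"
      using AB by blast
    ultimately have "connected_component (- (X \<union> path_image g)) a b"
      by simp
    then show "U = W"
      using UW ab joinable_components_eq[of _ "- (X \<union> path_image g)" U W]
      unfolding connected_component_def by blast
  qed
  have "?S \<subseteq> {SOME U. U \<in> ?S}"
    using same someI[of "\<lambda>U. U \<in> ?S"] by blast
  then have "finite ?S \<and> card ?S \<le> card {SOME U. U \<in> ?S}"
    by (meson card_mono finite.emptyI finite_insert finite_subset)
  then show ?thesis by auto
qed

text \<open>Each piece lies inside the path component of \<open>u\<close> or misses it, so sorting
  the finitely many compact pieces by this criterion gives the separation required for a
  bridge.\<close>

lemma finite_Union_path_connected_split:
  fixes \<C> :: "complex set set"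
  assumes fin: "finite \<C>" and pc: "\<And>C. C \<in> \<C> \<Longrightarrow> compact C \<and> path_connected C"
    and uv: "u \<in> \<Union>\<C>" "v \<in> \<Union>\<C>" and npc: "\<not> path_component (\<Union>\<C>) u v"
  obtains A B where "closed A" "compact B" "\<Union>\<C> = A \<union> B" "A \<inter> B = {}" "u \<in> A" "v \<in> B"
proof
  define K where "K = path_component_set (\<Union>\<C>) u"
  define A where "A = \<Union>{C \<in> \<C>. C \<subseteq> K}"
  define B where "B = \<Union>{C \<in> \<C>. \<not> C \<subseteq> K}"
  have dich: "C \<subseteq> K \<or> C \<inter> K = {}" if "C \<in> \<C>" for C
  proof -
    have "y \<in> K" if "x \<in> C" "x \<in> K" "y \<in> C" for x y
    proof -
      have "path_component C x y"
        using pc \<open>C \<in> \<C>\<close> that by (simp add: path_connected_component)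
      then have "path_component (\<Union>\<C>) x y"
        by (rule path_component_of_subset[rotated]) (use \<open>C \<in> \<C>\<close> in blast)
      then show ?thesis
        using that(2) path_component_trans unfolding K_def by fast
    qed
    then show ?thesis by blast
  qed
  have "u \<in> K"
    using uv(1) unfolding K_def by (simp add: path_component_refl)
  moreover have "v \<notin> K"
    using npc unfolding K_def by simp
  ultimately show "u \<in> A" "v \<in> B"
    using uv dich unfolding A_def B_def by blast+
  show "closed A"
    unfolding A_def using fin pc by (intro closed_Union) (auto simp: compact_imp_closed)
  show "compact B"
    unfolding B_def using fin pc by (intro compact_Union) auto
  show "\<Union>\<C> = A \<union> B" "A \<inter> B = {}"
    unfolding A_def B_def using dich by blast+
qed

lemma path_component_arc:
  fixes X :: "complex set"
  assumes "path_component X u v" "u \<noteq> v"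
  obtains h where "arc h" "path_image h \<subseteq> X" "pathstart h = u" "pathfinish h = v"
proof -
  obtain p where p: "path p" "path_image p \<subseteq> X" "pathstart p = u" "pathfinish p = v"
    using assms(1) unfolding path_component_def by blast
  then obtain h where "arc h" "path_image h \<subseteq> path_image p" "pathstart h = u" "pathfinish h = v"
    using path_contains_arc[of p u v] assms(2) by blast
  with p that show thesis by blast
qed

text \<open>The new arc either closes a cycle, when its ends are already joined inside
  \<open>X\<close>, or is a bridge between two separated closed parts.\<close>

lemma card_touching_components_le_2:
  fixes \<C> :: "complex set set"
  assumes fin: "finite \<C>" and pc: "\<And>C. C \<in> \<C> \<Longrightarrow> compact C \<and> path_connected C"
    and X: "X = \<Union>\<C>" and g: "arc g" "path_image g \<inter> X = {pathstart g, pathfinish g}"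
  shows "finite {U \<in> components (- (X \<union> path_image g)). touches U g}" (is ?F)
    and "card {U \<in> components (- (X \<union> path_image g)). touches U g} \<le> 2" (is ?C)
proof -
  have "?F \<and> ?C"
  proof (cases "path_component X (pathfinish g) (pathstart g)")
    case True
    have "closed X"
      unfolding X using fin pc by (intro closed_Union) (auto simp: compact_imp_closed)
    moreover obtain h where "arc h" "path_image h \<subseteq> X" "pathstart h = pathfinish g" "pathfinish h = pathstart g"
      using path_component_arc[OF True] arc_distinct_ends[OF g(1)] by metis
    ultimately show ?thesis
      by (intro touching_components_cycle g)
  next
    case False
    then have "\<not> path_component (\<Union>\<C>) (pathstart g) (pathfinish g)"
      using X path_component_sym by blast
    moreover have "pathstart g \<in> \<Union>\<C>" "pathfinish g \<in> \<Union>\<C>"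
      using g(2) X by auto
    ultimately obtain A B where "closed A" "compact B" "\<Union>\<C> = A \<union> B" "A \<inter> B = {}"
        "pathstart g \<in> A" "pathfinish g \<in> B"
      using finite_Union_path_connected_split[OF fin pc] by blast
    then show ?thesis
      using touching_components_bridge[OF g] X by blast
  qed
  then show ?F ?C by blast+
qed

section \<open>Growth of the number of faces when an arc is added\<close>

text \<open>Otherwise the inverse of the parametrisation would embed a nonempty open set of the
  plane into the line, against invariance of dimension.\<close>

lemma open_subset_arc_empty:
  fixes g :: "real \<Rightarrow> complex"
  assumes "arc g" "open W" "W \<subseteq> path_image g"
  shows "W = {}"
proof (rule ccontr)
  assume "W \<noteq> {}"
  obtain h where h: "homeomorphism {0..1} (path_image g) g h"
    using assms(1) homeomorphism_arc by blast
  have "continuous_on W h"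
    using h assms(3) continuous_on_subset homeomorphism_cont2 by blast
  moreover have "inj_on h W"
    using h assms(3) by (metis homeomorphism_apply2 inj_on_inverseI subsetD)
  ultimately have "DIM(complex) \<le> DIM(real)"
    using invariance_of_dimension[of W h] assms(2) \<open>W \<noteq> {}\<close> by blast
  then show False by simp
qed

lemma component_refine:
  fixes X :: "complex set"
  assumes X: "closed X" and g: "arc g" and W: "W \<in> components (- X)"
  shows "\<exists>U \<in> components (- (X \<union> path_image g)). U \<subseteq> W"
proof -
  have "open W" "W \<noteq> {}"
    using open_components[OF _ W] X in_components_nonempty[OF W] by (auto simp: open_Compl)
  then obtain x where x: "x \<in> W" "x \<notin> path_image g"
    using open_subset_arc_empty[OF g] by blast
  then have xX: "x \<in> - (X \<union> path_image g)"
    using in_components_subset[OF W] by blast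
  let ?U = "connected_component_set (- (X \<union> path_image g)) x"
  have "?U \<in> components (- (X \<union> path_image g))"
    using xX by (rule componentsI)
  moreover have "?U \<subseteq> W"
    by (rule components_maximal[OF W])
      (use x xX connected_component_subset[of "- (X \<union> path_image g)" x] in auto)
  ultimately show ?thesis by blast
qed

text \<open>Distinct components of \<open>- X\<close> are disjoint, so choosing a new component
  inside each old one is injective; comparing face numbers reduces to this choice function.\<close>

lemma component_refine_inj:
  fixes X :: "complex set"
  assumes X: "closed X" and g: "arc g"
  shows "\<exists>r. inj_on r (components (- X)) \<and>
    (\<forall>W \<in> components (- X). r W \<in> components (- (X \<union> path_image g)) \<and> r W \<subseteq> W)"
proof -
  obtain r where r: "\<And>W. W \<in> components (- X) \<Longrightarrow> r W \<in> components (- (X \<union> path_image g)) \<and> r W \<subseteq> W"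
    using component_refine[OF X g] by metis
  moreover have "inj_on r (components (- X))"
  proof (rule inj_onI)
    fix W W' assume W: "W \<in> components (- X)" "W' \<in> components (- X)" "r W = r W'"
    then have "r W \<noteq> {}" "r W \<subseteq> W" "r W \<subseteq> W'"
      using r[of W] r[of W'] in_components_nonempty by auto
    then show "W = W'"
      using W components_eq by blast
  qed
  ultimately show ?thesis by blast
qed

lemma card_components_add_arc:
  fixes X :: "complex set"
  assumes X: "closed X" and g: "arc g" and fin: "finite (components (- (X \<union> path_image g)))"
  shows "card (components (- X)) \<le> card (components (- (X \<union> path_image g)))"
proof -
  obtain r where "inj_on r (components (- X))"
    "\<And>W. W \<in> components (- X) \<Longrightarrow> r W \<in> components (- (X \<union> path_image g)) \<and> r W \<subseteq> W"
    using component_refine_inj[OF X g] by blast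
  then show ?thesis
    using fin by (intro card_inj_on_le) auto
qed

text \<open>By the Jordan curve theorem both sides of the closed curve accumulate at an inner point of
  \<open>g\<close>, so \<open>g\<close> cuts its face in two.\<close>

lemma card_components_close_cycle:
  fixes X :: "complex set"
  assumes X: "closed X" and g: "arc g" "path_image g \<inter> X = {pathstart g, pathfinish g}"
    and h: "path_component X (pathfinish g) (pathstart g)"
    and fin: "finite (components (- (X \<union> path_image g)))"
  shows "card (components (- X)) < card (components (- (X \<union> path_image g)))"
proof -
  let ?Y = "X \<union> path_image g"
  obtain h where h: "arc h" "path_image h \<subseteq> X" "pathstart h = pathfinish g" "pathfinish h = pathstart g"
    using path_component_arc[OF h] arc_distinct_ends[OF g(1)] by metis
  define C where "C = path_image (g +++ h)"
  note loop = loop_from_arcs[OF g h]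
  note J = Jordan_inside_outside[OF loop(1,2), folded C_def]
  have CY: "C \<subseteq> ?Y" and gC: "path_image g \<subseteq> C"
    using loop(3) h(2) unfolding C_def by auto
  have "path_image g - {pathstart g, pathfinish g} \<noteq> {}"
    by (rule nonempty_simple_path_endless) (simp add: g(1) arc_imp_simple_path)
  then obtain x where x: "x \<in> path_image g" "x \<notin> X"
    using g(2) by blast
  then obtain d where d: "d > 0" "ball x d \<subseteq> - X"
    using X open_contains_ball[of "- X"] by (auto simp: open_Compl)
  have "x \<in> frontier (inside C)" "x \<in> frontier (outside C)"
    using J gC x by auto
  then obtain a b where ab: "a \<in> inside C" "b \<in> outside C" "a \<in> ball x d" "b \<in> ball x d"
    using d(1) unfolding frontier_straddle mem_ball by meson
  have aY: "a \<in> - ?Y" and bY: "b \<in> - ?Y"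
    using ab d(2) J gC by blast+
  define Ua where "Ua = connected_component_set (- ?Y) a"
  define Ub where "Ub = connected_component_set (- ?Y) b"
  have Uab: "Ua \<in> components (- ?Y)" "Ub \<in> components (- ?Y)" "a \<in> Ua" "b \<in> Ub"
    unfolding Ua_def Ub_def using aY bY by (auto simp: componentsI)
  have "Ua \<noteq> Ub"
  proof
    assume "Ua = Ub"
    then have "b \<in> Ua" using Uab by simp
    moreover have "connected Ua" "Ua \<subseteq> - C"
      using Uab(1) in_components_connected in_components_subset CY by blast+
    ultimately have "inside C \<inter> Ua = {} \<or> outside C \<inter> Ua = {}"
      using J connectedD[of Ua "inside C" "outside C"] by blast
    then show False using ab Uab(3) \<open>b \<in> Ua\<close> by blast
  qed
  \<comment> \<open>The ball around \<open>x\<close> avoids \<open>X\<close>, so both sides of the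
    curve near \<open>x\<close> belong to one old face \<open>W\<close>.\<close>
  obtain W where W: "W \<in> components (- X)" "ball x d \<subseteq> W"
    using exists_component_superset[OF d(2)] d x(2) by auto
  have sub: "Ua \<subseteq> W" "Ub \<subseteq> W"
    using Uab ab W in_components_connected in_components_subset
    by (intro components_maximal[OF W(1)]; blast)+
  obtain r where r: "inj_on r (components (- X))"
    "\<And>W. W \<in> components (- X) \<Longrightarrow> r W \<in> components (- ?Y) \<and> r W \<subseteq> W"
    using component_refine_inj[OF X g(1)] by blast
  \<comment> \<open>The choice \<open>r\<close> selects a single new face inside \<open>W\<close>,
    so whichever of \<open>Ua\<close> and \<open>Ub\<close> differs from it is not in the range of
    \<open>r\<close>. Hence the injection is not onto.\<close>
  have miss: "U \<notin> r ` components (- X)" if "U \<in> {Ua, Ub}" "U \<noteq> r W" for U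
  proof
    assume "U \<in> r ` components (- X)"
    then obtain W' where W': "W' \<in> components (- X)" "U = r W'" by blast
    then have "U \<subseteq> W'" "U \<subseteq> W" "U \<noteq> {}"
      using r(2) that(1) sub Uab by auto
    then have "W' = W"
      using components_eq[OF W'(1) W(1)] by blast
    then show False using W' that by simp
  qed
  obtain U where "U \<in> {Ua, Ub}" "U \<noteq> r W"
    using \<open>Ua \<noteq> Ub\<close> by blast
  then have "U \<in> components (- ?Y)" "U \<notin> r ` components (- X)"
    using miss Uab by auto
  moreover have "r ` components (- X) \<subseteq> components (- ?Y)"
    using r(2) by blast
  ultimately have "r ` components (- X) \<subset> components (- ?Y)"
    by blast
  then have "card (r ` components (- X)) < card (components (- ?Y))"
    using fin by (rule psubset_card_mono[rotated])
  then show ?thesis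
    using card_image[OF r(1)] by simp
qed

subsection \<open>Euler's inequality for plane graphs\<close>

text \<open>On \<open>P\<close> the map \<open>r'\<close> factors through \<open>r\<close>. If two
  distinct values of \<open>r\<close> are merged, the factor is not injective. This counts connected
  pieces before and after the insertion of an edge.\<close>

lemma card_image_coarsen:
  assumes "finite P" and "\<And>x y. x \<in> P \<Longrightarrow> y \<in> P \<Longrightarrow> r x = r y \<Longrightarrow> r' x = r' y"
  shows "card (r' ` P) \<le> card (r ` P)"
    and "x \<in> P \<Longrightarrow> y \<in> P \<Longrightarrow> r x \<noteq> r y \<Longrightarrow> r' x = r' y \<Longrightarrow> card (r' ` P) < card (r ` P)"
proof -
  define h where "h = r' \<circ> inv_into P r"
  have h: "h (r z) = r' z" if "z \<in> P" for z
    using that assms(2) unfolding h_def comp_def by (metis f_inv_into_f imageI inv_into_into)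
  then have im: "r' ` P = h ` (r ` P)"
    by (simp add: image_image cong: image_cong)
  show le: "card (r' ` P) \<le> card (r ` P)"
    unfolding im using assms(1) by (simp add: card_image_le)
  assume xy: "x \<in> P" "y \<in> P" "r x \<noteq> r y" "r' x = r' y"
  have "card (r' ` P) \<noteq> card (r ` P)"
  proof
    assume "card (r' ` P) = card (r ` P)"
    then have "inj_on h (r ` P)"
      unfolding im using assms(1) by (simp add: eq_card_imp_inj_on)
    then show False
      using xy h by (metis image_eqI inj_onD)
  qed
  with le show "card (r' ` P) < card (r ` P)" by simp
qed

text \<open>Vertices are points of the plane and edges are abstract indices of arcs. Isolated
  vertices and parallel edges are allowed; loops are excluded since an arc has distinct
  ends.\<close>

locale plane_graph =
  fixes P :: "complex set" and A :: "'e set" and c :: "'e \<Rightarrow> real \<Rightarrow> complex"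
  assumes finite_P: "finite P" and finite_A: "finite A"
    and arc: "e \<in> A \<Longrightarrow> arc (c e)"
    and image_Int_P: "e \<in> A \<Longrightarrow> path_image (c e) \<inter> P = {pathstart (c e), pathfinish (c e)}"
    and image_Int_image: "e \<in> A \<Longrightarrow> e' \<in> A \<Longrightarrow> e \<noteq> e' \<Longrightarrow> path_image (c e) \<inter> path_image (c e') \<subseteq> P"
begin

definition drawing :: "'e set \<Rightarrow> complex set" where
  "drawing B = P \<union> (\<Union>e\<in>B. path_image (c e))"

abbreviation faces :: "'e set \<Rightarrow> complex set set" where
  "faces B \<equiv> components (- drawing B)"

lemma drawing_insert: "drawing (insert e B) = drawing B \<union> path_image (c e)"
  by (auto simp: drawing_def)

lemma finite_subset_A: "B \<subseteq> A \<Longrightarrow> finite B"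
  using finite_A finite_subset by blast

lemma drawing_eq_Union: "drawing B = \<Union>((\<lambda>x. {x}) ` P \<union> (\<lambda>e. path_image (c e)) ` B)"
  by (auto simp: drawing_def)

lemma path_connected_edge: "e \<in> A \<Longrightarrow> path_connected (path_image (c e))"
  by (simp add: arc arc_imp_path path_connected_path_image)

lemma drawing_pieces:
  assumes "B \<subseteq> A"
  shows "finite ((\<lambda>x. {x}) ` P \<union> (\<lambda>e. path_image (c e)) ` B)"
    "C \<in> (\<lambda>x. {x}) ` P \<union> (\<lambda>e. path_image (c e)) ` B \<Longrightarrow> compact C \<and> path_connected C"
  using assms finite_P finite_subset_A arc path_connected_edge
  by (auto simp: compact_arc_image)

lemma compact_drawing: "B \<subseteq> A \<Longrightarrow> compact (drawing B)"
  unfolding drawing_eq_Union using drawing_pieces by (intro compact_Union) auto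

lemma image_Int_drawing:
  assumes "B \<subseteq> A" "e \<in> A" "e \<notin> B"
  shows "path_image (c e) \<inter> drawing B = {pathstart (c e), pathfinish (c e)}"
  using image_Int_P[OF assms(2)] image_Int_image[OF assms(2)] assms unfolding drawing_def by blast

lemma touching_faces:
  assumes "B \<subseteq> A" "e \<in> A" "e \<notin> B"
  shows "finite {U \<in> faces (insert e B). touches U (c e)}"
    "card {U \<in> faces (insert e B). touches U (c e)} \<le> 2"
  unfolding drawing_insert
  using card_touching_components_le_2[OF drawing_pieces[OF assms(1)] drawing_eq_Union
      arc[OF assms(2)] image_Int_drawing[OF assms]]
  by blast+

lemma faces_empty: "faces {} = {- P}"
proof -
  have "connected (- P)"
    using connected_open_delete_finite[of UNIV P] finite_P
    by (simp add: Compl_eq_Diff_UNIV convex_connected)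
  moreover have "- P \<noteq> {}"
    using finite_P infinite_UNIV_char_0[where 'a = complex] by (metis Compl_empty_eq double_compl)
  ultimately show ?thesis
    by (simp add: drawing_def components_eq_sing_iff)
qed

text \<open>For \<open>B\<close> inside \<open>A\<close> every path component of the drawing
  contains a vertex, so the image of \<open>P\<close> lists all of them.\<close>

abbreviation pieces :: "'e set \<Rightarrow> complex set set" where
  "pieces B \<equiv> path_component_set (drawing B) ` P"

text \<open>Edges are inserted one at a time. An edge with both ends in one piece adds a face, and
  any other edge merges two pieces without losing a face.\<close>

lemma euler_inequality:
  assumes "B \<subseteq> A"
  shows "finite (faces B) \<and> card B + card (pieces B) + 1 \<le> card (faces B) + card P"
  using finite_subset_A[OF assms] assms
proof (induction B)
  case empty
  then show ?case
    using finite_P by (simp add: faces_empty card_image_le)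
next
  case (insert e B)
  let ?g = "c e"
  have B: "B \<subseteq> A" and e: "e \<in> A" "e \<notin> B"
    using insert by auto
  have IH: "finite (faces B)" "card B + card (pieces B) + 1 \<le> card (faces B) + card P"
    using insert B by auto
  note g = arc[OF e(1)] image_Int_drawing[OF B e]
  have cl: "closed (drawing B)"
    using compact_drawing[OF B] by (rule compact_imp_closed)
  \<comment> \<open>Each face of the enlarged drawing is an old one or one of the at most two that
    touch \<open>e\<close>. Finiteness must be carried along since \<open>card\<close> is 0 on
    infinite sets.\<close>
  have "faces (insert e B) \<subseteq> faces B \<union> {U \<in> faces (insert e B). touches U ?g}"
    using untouched_component[OF cl g] unfolding drawing_insert by blast
  then have fin: "finite (faces (insert e B))"
    using IH(1) touching_faces(1)[OF B e] by (meson finite_Un finite_subset)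
  then have fin': "finite (components (- (drawing B \<union> path_image ?g)))"
    by (simp only: drawing_insert)
  have ends: "pathstart ?g \<in> P" "pathfinish ?g \<in> P"
    using image_Int_P[OF e(1)] by auto
  have coarse: "path_component_set (drawing (insert e B)) x = path_component_set (drawing (insert e B)) y"
    if "x \<in> P" "y \<in> P" "path_component_set (drawing B) x = path_component_set (drawing B) y" for x y
  proof -
    have "y \<in> path_component_set (drawing B) y"
      using that(2) by (simp add: path_component_refl drawing_def)
    then have "path_component (drawing B) x y"
      using that(3) by blast
    then have "path_component (drawing (insert e B)) x y"
      by (rule path_component_of_subset[rotated]) (auto simp: drawing_insert)
    then show ?thesis
      by (simp add: path_component_eq)
  qed
  note le = card_image_coarsen[OF finite_P, of "path_component_set (drawing B)"
      "path_component_set (drawing (insert e B))", OF coarse]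
  have card_insert: "card (insert e B) = card B + 1"
    using insert.hyps by simp
  show ?case
  proof (cases "path_component (drawing B) (pathfinish ?g) (pathstart ?g)")
    case True
    have "card (faces B) < card (faces (insert e B))"
      unfolding drawing_insert by (rule card_components_close_cycle[OF cl g True fin'])
    moreover have "card (pieces (insert e B)) \<le> card (pieces B)"
      by (rule le(1))
    ultimately show ?thesis
      using IH(2) fin card_insert by linarith
  next
    case False
    have "card (faces B) \<le> card (faces (insert e B))"
      unfolding drawing_insert by (rule card_components_add_arc[OF cl g(1) fin'])
    moreover have "card (pieces (insert e B)) < card (pieces B)"
    proof (rule le(2))
      show "path_component_set (drawing B) (pathfinish ?g) \<noteq> path_component_set (drawing B) (pathstart ?g)"
        using False ends by (metis UnI1 drawing_def mem_Collect_eq path_component_refl)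
      have "path_component (path_image ?g) (pathfinish ?g) (pathstart ?g)"
        using path_connected_edge[OF e(1)] unfolding path_connected_component by blast
      then have "path_component (drawing (insert e B)) (pathfinish ?g) (pathstart ?g)"
        by (rule path_component_of_subset[rotated]) (auto simp: drawing_insert)
      then show "path_component_set (drawing (insert e B)) (pathfinish ?g) =
          path_component_set (drawing (insert e B)) (pathstart ?g)"
        by (simp add: path_component_eq)
    qed (use ends in auto)
    ultimately show ?thesis
      using IH(2) fin card_insert by linarith
  qed
qed

section \<open>Face boundaries and double counting\<close>

text \<open>All degrees inside \<open>T\<close> are at least two at the ends of its edges. A set of
  edges with no nonempty leafless subset is a forest, so cycles never have to be defined.\<close>

definition leafless :: "'e set \<Rightarrow> bool" where
  "leafless T \<longleftrightarrow> (\<forall>e\<in>T. \<forall>x\<in>{pathstart (c e), pathfinish (c e)}.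
     \<exists>e'\<in>T. e' \<noteq> e \<and> x \<in> {pathstart (c e'), pathfinish (c e')})"

text \<open>A leaf edge meets the remaining edges at most in its other end. This intersection is
  connected, so by Janiszewski's theorem the leaf edge can be added without separating the
  plane.\<close>

lemma forest_complement_connected:
  assumes "T \<subseteq> A" "\<And>S. S \<subseteq> T \<Longrightarrow> S \<noteq> {} \<Longrightarrow> \<not> leafless S"
  shows "connected (- (\<Union>e\<in>T. path_image (c e)))"
  using finite_subset_A[OF assms(1)] assms
proof (induction T rule: finite_psubset_induct)
  case (psubset T)
  show ?case
  proof (cases "T = {}")
    case False
    then have "\<not> leafless T"
      using psubset.prems by blast
    then obtain e x where ex: "e \<in> T" "x \<in> {pathstart (c e), pathfinish (c e)}"
      "\<And>e'. e' \<in> T \<Longrightarrow> e' \<noteq> e \<Longrightarrow> x \<notin> {pathstart (c e'), pathfinish (c e')}"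
      unfolding leafless_def by blast
    let ?N = "\<Union>e'\<in>T - {e}. path_image (c e')"
    obtain y where y: "{pathstart (c e), pathfinish (c e)} = {x, y}"
      using ex(2) by blast
    have eA: "e \<in> A" using ex psubset.prems by blast
    have "path_image (c e) \<inter> ?N \<subseteq> {y}"
    proof
      fix z assume z: "z \<in> path_image (c e) \<inter> ?N"
      then obtain e' where e': "e' \<in> T" "e' \<noteq> e" "z \<in> path_image (c e')" by blast
      have e'A: "e' \<in> A" using e' psubset.prems by blast
      have "z \<in> P"
        using image_Int_image[OF eA e'A] e' z by blast
      then have "z \<in> {x, y}" "z \<in> {pathstart (c e'), pathfinish (c e')}"
        using image_Int_P[OF eA] image_Int_P[OF e'A] e' z y by blast+
      then show "z \<in> {y}" using ex(3)[OF e'(1,2)] by blast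
    qed
    then have "path_image (c e) \<inter> ?N = {} \<or> path_image (c e) \<inter> ?N = {y}"
      by blast
    then have conn: "connected (path_image (c e) \<inter> ?N)"
      by auto
    have "connected (- ?N)"
      using psubset.IH[of "T - {e}"] psubset.prems ex(1) by blast
    moreover have "connected (- path_image (c e))"
      using arc[OF eA] by (simp add: connected_arc_complement)
    moreover have "closed ?N"
      using psubset.prems(1) psubset.hyps arc by (intro closed_UN) (auto simp: closed_arc_image)
    moreover have "compact (path_image (c e))"
      using arc[OF eA] by (simp add: compact_arc_image)
    ultimately have "connected (- (path_image (c e) \<union> ?N))"
      using Janiszewski_connected conn by blast
    moreover have "path_image (c e) \<union> ?N = (\<Union>e\<in>T. path_image (c e))"
      using ex(1) by blast
    ultimately show ?thesis by simp
  qed (simp add: convex_connected)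
qed

text \<open>Otherwise the edges on the boundary of \<open>U\<close> form a forest, which does not separate the plane,
  so \<open>U\<close> would be the only face.\<close>

lemma face_touches_leafless:
  assumes U: "U \<in> faces A" and two: "1 < card (faces A)"
  shows "\<exists>S. S \<subseteq> {e \<in> A. touches U (c e)} \<and> S \<noteq> {} \<and> leafless S"
proof (rule ccontr)
  assume none: "\<not> ?thesis"
  let ?T = "{e \<in> A. touches U (c e)}"
  have "connected (- (\<Union>e\<in>?T. path_image (c e)))"
    using none by (intro forest_complement_connected) auto
  moreover have "open (- (\<Union>e\<in>?T. path_image (c e)))"
    using arc finite_A by (intro open_Compl closed_UN) (auto simp: closed_arc_image)
  \<comment> \<open>Vertices off the touched edges also belong to the drawing; deleting finitely
    many points from a connected open set keeps it connected.\<close>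
  ultimately have "connected (- (\<Union>e\<in>?T. path_image (c e)) - P)"
    using finite_P by (intro connected_open_delete_finite) auto
  moreover have "- (\<Union>e\<in>?T. path_image (c e)) - P = - drawing ?T"
    by (auto simp: drawing_def)
  ultimately have conn: "connected (- drawing ?T)" by simp
  have "frontier U \<subseteq> drawing A"
    using U compact_drawing[of A] by (intro frontier_of_components_closed_complement) (auto simp: compact_imp_closed)
  have fr: "frontier U \<subseteq> drawing ?T"
  proof
    fix z assume z: "z \<in> frontier U"
    then consider "z \<in> P" | e where "e \<in> A" "z \<in> path_image (c e)" "z \<notin> P"
      using \<open>frontier U \<subseteq> drawing A\<close> unfolding drawing_def by blast
    then show "z \<in> drawing ?T"
    proof cases
      case (2 e)
      then have "touches U (c e)"
        using z image_Int_P[OF 2(1)] unfolding touches_def by blast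
      then show ?thesis using 2 unfolding drawing_def by blast
    qed (simp add: drawing_def)
  qed
  have sub: "- drawing A \<subseteq> - drawing ?T"
    unfolding drawing_def by blast
  \<comment> \<open>A connected set that meets \<open>U\<close> and leaves it would contain a
    frontier point of \<open>U\<close>, but the frontier lies in \<open>drawing ?T\<close>.\<close>
  have "- drawing ?T \<subseteq> U"
  proof (rule ccontr)
    assume "\<not> ?thesis"
    moreover have "- drawing ?T \<inter> U \<noteq> {}"
      using in_components_subset[OF U] in_components_nonempty[OF U] sub by blast
    ultimately have "- drawing ?T \<inter> frontier U \<noteq> {}"
      using conn by (intro connected_Int_frontier) auto
    then show False using fr by blast
  qed
  then have "- drawing A = U"
    using in_components_subset[OF U] sub by blast
  then have "faces A = {U}"
    using U components_eq_sing_iff[of "- drawing A"] in_components_connected[OF U] in_components_nonempty[OF U]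
    by simp
  then show False using two by simp
qed

text \<open>With at least two faces, counting incidences gives twice as many edges as faces, and
  Euler's inequality yields even \<open>card A + 4 \<le> 2 * card P\<close>. The stated constant
  also covers a single face, where the drawing is a forest and may be just one vertex.\<close>

theorem edge_bound_girth_4:
  assumes girth: "\<And>S. S \<subseteq> A \<Longrightarrow> S \<noteq> {} \<Longrightarrow> leafless S \<Longrightarrow> 4 \<le> card S" and "P \<noteq> {}"
  shows "card A + 2 \<le> 2 * card P"
proof -
  have fin: "finite (faces A)" and euler: "card A + card (pieces A) + 1 \<le> card (faces A) + card P"
    using euler_inequality[of A] by auto
  have "card (pieces A) \<ge> 1" "card P \<ge> 1"
    using finite_P \<open>P \<noteq> {}\<close> by (simp_all add: Suc_le_eq card_gt_0_iff)
  show ?thesis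
  proof (cases "1 < card (faces A)")
    case False
    then show ?thesis
      using euler \<open>card (pieces A) \<ge> 1\<close> \<open>card P \<ge> 1\<close> by linarith
  next
    case True
    have "4 * card (faces A) \<le> (\<Sum>U\<in>faces A. card {e \<in> A. touches U (c e)})"
    proof -
      have "4 \<le> card {e \<in> A. touches U (c e)}" if U: "U \<in> faces A" for U
      proof -
        obtain S where S: "S \<subseteq> {e \<in> A. touches U (c e)}" "S \<noteq> {}" "leafless S"
          using face_touches_leafless[OF U True] by blast
        then have "4 \<le> card S" using girth by blast
        also have "\<dots> \<le> card {e \<in> A. touches U (c e)}"
          using S(1) finite_A by (intro card_mono) auto
        finally show ?thesis .
      qed
      then show ?thesis
        using sum_bounded_below[of "faces A" 4 "\<lambda>U. card {e \<in> A. touches U (c e)}"] by (simp add: mult.commute)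
    qed
    also have "\<dots> = (\<Sum>e\<in>A. card {U \<in> faces A. touches U (c e)})"
      unfolding card_eq_sum using fin finite_A by (rule sum.swap_restrict)
    also have "\<dots> \<le> (\<Sum>e\<in>A. 2)"
    proof (rule sum_mono)
      fix e assume "e \<in> A"
      \<comment> \<open>The edge \<open>e\<close> is treated as the last one inserted, on top of
        \<open>A - {e}\<close>.\<close>
      then show "card {U \<in> faces A. touches U (c e)} \<le> 2"
        using touching_faces(2)[of "A - {e}" e] by (simp add: insert_absorb)
    qed
    also have "\<dots> = 2 * card A" by simp
    finally have "2 * card (faces A) \<le> card A" by simp
    with euler \<open>card (pieces A) \<ge> 1\<close> show ?thesis by linarith
  qed
qed

end

section \<open>The edge bound for planar bipartite graphs\<close>

text \<open>Starting from an edge \<open>{x, y}\<close>, both ends have a second edge,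
  \<open>{x, y'}\<close> and \<open>{x', y}\<close>, and \<open>y'\<close> has a second edge
  \<open>{x'', y'}\<close>. The two sides keep the four edges distinct, although \<open>x''\<close>
  may equal \<open>x'\<close>.\<close>

lemma bipartite_leafless_card:
  assumes fin: "finite S" and ne: "S \<noteq> {}"
    and bip: "\<And>e. e \<in> S \<Longrightarrow> \<exists>x y. e = {x, y} \<and> side x \<and> \<not> side y"
    and leafless: "\<And>e x. e \<in> S \<Longrightarrow> x \<in> e \<Longrightarrow> \<exists>e'\<in>S. e' \<noteq> e \<and> x \<in> e'"
  shows "4 \<le> card S"
proof -
  obtain e1 x y where e1: "e1 \<in> S" "e1 = {x, y}" "side x" "\<not> side y"
    using ne bip by blast
  obtain e2 y' where e2: "e2 \<in> S" "e2 \<noteq> e1" "e2 = {x, y'}" "\<not> side y'"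
    using leafless[OF e1(1), of x] bip e1 by (metis insertE insertI1 singletonD)
  obtain e3 x' where e3: "e3 \<in> S" "e3 \<noteq> e1" "e3 = {x', y}" "side x'"
    using leafless[OF e1(1), of y] bip e1 by (metis insertE insertI1 insertI2 singletonD)
  obtain e4 x'' where e4: "e4 \<in> S" "e4 \<noteq> e2" "e4 = {x'', y'}" "side x''"
    using leafless[OF e2(1), of y'] bip e2 by (metis insertE insertI1 insertI2 singletonD)
  have "y' \<noteq> y" "x' \<noteq> x" "x'' \<noteq> x"
    using e1 e2 e3 e4 by auto
  then have "card {e1, e2, e3, e4} = 4"
    using e1 e2 e3 e4 by (auto simp: doubleton_eq_iff card_insert_if)
  moreover have "card {e1, e2, e3, e4} \<le> card S"
    using e1(1) e2(1) e3(1) e4(1) fin by (intro card_mono) auto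
  ultimately show ?thesis by simp
qed

theorem planar_bipartite_edge_bound:
  fixes V :: "'a set"
  assumes planar: "planar (V, E)" and V: "finite V" "V \<noteq> {}"
    and bip: "\<And>e. e \<in> E \<Longrightarrow> e \<subseteq> V \<and> (\<exists>x y. e = {x, y} \<and> side x \<and> \<not> side y)"
  shows "card E + 2 \<le> 2 * card V"
proof -
  obtain pos :: "'a \<Rightarrow> complex" and c where "inj_on pos V \<and>
     (\<forall>e\<in>E. arc (c e) \<and> {pathstart (c e), pathfinish (c e)} = pos ` e \<and>
                 path_image (c e) \<inter> pos ` V = pos ` e) \<and>
     (\<forall>e\<in>E. \<forall>e'\<in>E. e \<noteq> e' \<longrightarrow> path_image (c e) \<inter> path_image (c e') \<subseteq> pos ` (e \<inter> e'))"
    using planar unfolding planar_def fst_conv snd_conv by (elim exE) blast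
  then have inj: "inj_on pos V"
    and c: "\<And>e. e \<in> E \<Longrightarrow> arc (c e) \<and> {pathstart (c e), pathfinish (c e)} = pos ` e \<and>
                 path_image (c e) \<inter> pos ` V = pos ` e"
    and cc: "\<And>e e'. e \<in> E \<Longrightarrow> e' \<in> E \<Longrightarrow> e \<noteq> e' \<Longrightarrow>
                 path_image (c e) \<inter> path_image (c e') \<subseteq> pos ` (e \<inter> e')"
    by simp_all
  have "finite E"
    using bip V(1) by (intro finite_subset[of E "Pow V"]) auto
  interpret plane_graph "pos ` V" E c
  proof
    fix e e' assume "e \<in> E" "e' \<in> E" "e \<noteq> e'"
    then show "path_image (c e) \<inter> path_image (c e') \<subseteq> pos ` V"
      using cc[of e e'] bip[of e] by blast
  qed (use V c \<open>finite E\<close> in auto)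
  have "card E + 2 \<le> 2 * card (pos ` V)"
  proof (rule edge_bound_girth_4)
    fix S assume S: "S \<subseteq> E" "S \<noteq> {}" "leafless S"
    show "4 \<le> card S"
    proof (rule bipartite_leafless_card)
      show "finite S" using S(1) \<open>finite E\<close> finite_subset by blast
      show "\<exists>x y. e = {x, y} \<and> side x \<and> \<not> side y" if "e \<in> S" for e
        using bip that S by blast
      fix e x assume e: "e \<in> S" "x \<in> e"
      have "pos x \<in> {pathstart (c e), pathfinish (c e)}"
        using c[of e] e S(1) by blast
      then obtain e' where e': "e' \<in> S" "e' \<noteq> e" "pos x \<in> {pathstart (c e'), pathfinish (c e')}"
        using S(3) e(1) unfolding leafless_def by blast
      then have "pos x \<in> pos ` e'"
        using c[of e'] S(1) by blast
      moreover have "e' \<subseteq> V" "x \<in> V"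
        using conjunct1[OF bip, of e'] conjunct1[OF bip, of e] e e'(1) S(1) by auto
      ultimately have "x \<in> e'"
        using inj by (meson inj_on_image_mem_iff)
      with e' show "\<exists>e'\<in>S. e' \<noteq> e \<and> x \<in> e'" by blast
    qed (use S in auto)
  qed (use V in auto)
  then show ?thesis
    using card_image[OF inj] by simp
qed

subsection \<open>Two-page book embeddings\<close>

text \<open>The parabola with height \<open>s * (x - l) * (h - x)\<close> above \<open>x\<close>.
  The sign \<open>s = 1\<close> or \<open>s = -1\<close> selects the page.\<close>

definition lobe :: "real \<Rightarrow> real \<Rightarrow> real \<Rightarrow> real \<Rightarrow> complex" where
  "lobe s l h t = Complex (l + t * (h - l)) (s * (t * (h - l)) * ((1 - t) * (h - l)))"

lemma lobe_ends [simp]: "pathstart (lobe s l h) = Complex l 0" "pathfinish (lobe s l h) = Complex h 0"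
  by (simp_all add: pathstart_def pathfinish_def lobe_def)

lemma arc_lobe: "l < h \<Longrightarrow> arc (lobe s l h)"
  unfolding arc_def path_def lobe_def Complex_eq inj_on_def
  by (auto intro!: continuous_intros simp: complex_eq_iff)

lemma mem_lobe:
  assumes "z \<in> path_image (lobe s l h)" "l < h"
  shows "l \<le> Re z" "Re z \<le> h" "Im z = s * (Re z - l) * (h - Re z)"
proof -
  obtain t where t: "0 \<le> t" "t \<le> 1" "z = lobe s l h t"
    using assms(1) by (auto simp: path_image_def)
  have "0 \<le> t * (h - l)" "0 \<le> (1 - t) * (h - l)"
    using t assms(2) by auto
  then show "l \<le> Re z" "Re z \<le> h"
    unfolding t(3) lobe_def by (auto simp: algebra_simps)
  show "Im z = s * (Re z - l) * (h - Re z)"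
    unfolding t(3) lobe_def by (simp add: algebra_simps)
qed

text \<open>Strictly inside the inner interval both factors of the outer parabola are at least those
  of the inner one, and one is larger, so the outer parabola is strictly higher.\<close>

lemma nested_lobes:
  fixes x :: real
  assumes "l \<le> l'" "h' \<le> h" "(l, h) \<noteq> (l', h')" "l' \<le> x" "x \<le> h'"
    and eq: "(x - l) * (h - x) = (x - l') * (h' - x)"
  shows "x \<in> {l', h'}"
proof (rule ccontr)
  assume "x \<notin> {l', h'}"
  then have "0 < x - l'" "0 < h' - x"
    using assms by auto
  moreover have "(x - l') * (h' - x) < (x - l) * (h - x)"
  proof (cases "l < l'")
    case True
    then show ?thesis
      using calculation assms by (intro mult_less_le_imp_less) auto
  next
    case False
    then show ?thesis
      using calculation assms by (intro mult_le_less_imp_less) auto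
  qed
  ultimately show False using eq by simp
qed

text \<open>On different pages the heights have opposite signs and must vanish. On one page the
  intervals are nested or have no common inner point.\<close>

lemma lobes_Int:
  assumes z: "z \<in> path_image (lobe s l h)" "z \<in> path_image (lobe s' l' h')"
    and lt: "l < h" "l' < h'" and s: "s \<in> {1, -1}" "s' \<in> {1, -1}"
    and ne: "(l, h) \<noteq> (l', h')"
    and nc: "s = s' \<Longrightarrow> \<not> (l < l' \<and> l' < h \<and> h < h') \<and> \<not> (l' < l \<and> l < h' \<and> h' < h)"
  shows "Im z = 0 \<and> Re z \<in> {l, h} \<and> Re z \<in> {l', h'}"
proof -
  define x where "x = Re z"
  note m = mem_lobe[OF z(1) lt(1), folded x_def] mem_lobe[OF z(2) lt(2), folded x_def]
  have prods: "0 \<le> (x - l) * (h - x)" "0 \<le> (x - l') * (h' - x)"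
    using m by simp_all
  have zero: "(x - l') * (h' - x) = 0 \<and> (x - l) * (h - x) = 0"
  proof (cases "s = s'")
    case False
    then show ?thesis
      using m(3,6) s prods by (auto simp: algebra_simps)
  next
    case True
    then have eq: "(x - l) * (h - x) = (x - l') * (h' - x)"
      using m(3,6) s by (auto simp: algebra_simps)
    consider "l \<le> l'" "h' \<le> h" | "l' \<le> l" "h \<le> h'" | "h \<le> l'" | "h' \<le> l"
      using nc[OF True] lt by linarith
    then show ?thesis
    proof cases
      case 1
      then show ?thesis using nested_lobes[OF _ _ ne m(4,5) eq] eq by auto
    next
      case 2
      then show ?thesis using nested_lobes[OF _ _ ne[symmetric] m(1,2) eq[symmetric]] eq by auto
    next
      case 3
      then have "x = h" "x = l'" using m by auto
      then show ?thesis by simp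
    next
      case 4
      then have "x = l" "x = h'" using m by auto
      then show ?thesis by simp
    qed
  qed
  then have "x \<in> {l, h}" "x \<in> {l', h'}" by auto
  moreover have "Im z = 0"
    using m(3) zero by (simp add: mult.assoc)
  ultimately show ?thesis unfolding x_def by simp
qed

text \<open>Nested pairs and pairs with a common end are permitted. The mirrored interleaving is
  excluded as well, by exchanging the two pairs.\<close>

definition noncrossing :: "(real \<Rightarrow> real \<Rightarrow> bool) \<Rightarrow> bool" where
  "noncrossing R \<longleftrightarrow> (\<forall>l h l' h'. R l h \<longrightarrow> R l' h' \<longrightarrow> \<not> (l < l' \<and> l' < h \<and> h < h'))"

text \<open>A two-page book embedding: the vertices lie on the real axis, the edges in the relation \<open>U\<close>
  are drawn as parabolas above it, and the remaining ones, in the relation \<open>L\<close>, below it.\<close>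

lemma planar_two_page_book:
  fixes p :: "'a \<Rightarrow> real"
  assumes inj: "inj_on p V"
    and edges: "\<And>e. e \<in> E \<Longrightarrow> e \<subseteq> V \<and> (\<exists>l h. l < h \<and> p ` e = {l, h} \<and> (U l h \<or> L l h))"
    and U: "noncrossing U" and L: "noncrossing L"
  shows "planar (V, E)"
proof -
  define pos where "pos v = Complex (p v) 0" for v
  define lo where "lo e = Min (p ` e)" for e
  define hi where "hi e = Max (p ` e)" for e
  \<comment> \<open>A pair that satisfies both relations is drawn above, so an edge below the axis
    fails \<open>U\<close> and hence satisfies \<open>L\<close>.\<close>
  define s where "s e = (if U (lo e) (hi e) then 1 else - 1 :: real)" for e
  define c where "c e = lobe (s e) (lo e) (hi e)" for e
  have e: "lo e < hi e" "p ` e = {lo e, hi e}" "U (lo e) (hi e) \<or> L (lo e) (hi e)" "e \<subseteq> V"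
    if "e \<in> E" for e
  proof -
    obtain l h where lh: "l < h" "p ` e = {l, h}" "U l h \<or> L l h"
      using edges \<open>e \<in> E\<close> by blast
    then have "lo e = l" "hi e = h"
      unfolding lo_def hi_def by auto
    with lh show "lo e < hi e" "p ` e = {lo e, hi e}" "U (lo e) (hi e) \<or> L (lo e) (hi e)"
      by simp_all
    show "e \<subseteq> V" using edges \<open>e \<in> E\<close> by blast
  qed
  have pos_e: "pos ` e = {Complex (lo e) 0, Complex (hi e) 0}" if "e \<in> E" for e
  proof -
    have "pos ` e = (\<lambda>x. Complex x 0) ` (p ` e)"
      unfolding pos_def by (simp add: image_image)
    then show ?thesis using e(2)[OF that] by simp
  qed
  show ?thesis
    unfolding planar_def fst_conv snd_conv
  proof (intro exI[of _ pos] exI[of _ c] conjI ballI impI)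
    show "inj_on pos V"
      using inj unfolding pos_def inj_on_def by simp
    fix e assume E: "e \<in> E"
    show "arc (c e)"
      unfolding c_def using e(1)[OF E] by (rule arc_lobe)
    show ends: "{pathstart (c e), pathfinish (c e)} = pos ` e"
      unfolding c_def pos_e[OF E] by simp
    show "path_image (c e) \<inter> pos ` V = pos ` e"
    proof
      show "pos ` e \<subseteq> path_image (c e) \<inter> pos ` V"
      proof -
        have "pos ` e \<subseteq> path_image (c e)"
          unfolding ends[symmetric] by (simp add: pathstart_in_path_image pathfinish_in_path_image)
        then show ?thesis using e(4)[OF E] by blast
      qed
      show "path_image (c e) \<inter> pos ` V \<subseteq> pos ` e"
      proof
        fix z assume z: "z \<in> path_image (c e) \<inter> pos ` V"
        then have "Im z = 0" unfolding pos_def by auto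
        moreover have "Im z = s e * (Re z - lo e) * (hi e - Re z)"
          using mem_lobe(3)[of z "s e" "lo e" "hi e"] z e(1)[OF E] unfolding c_def by blast
        moreover have "s e \<noteq> 0" unfolding s_def by simp
        ultimately have "Re z = lo e \<or> Re z = hi e" by auto
        with \<open>Im z = 0\<close> show "z \<in> pos ` e"
          unfolding pos_e[OF E] by (auto simp: complex_eq_iff)
      qed
    qed
    fix e' assume E': "e' \<in> E" "e \<noteq> e'"
    show "path_image (c e) \<inter> path_image (c e') \<subseteq> pos ` (e \<inter> e')"
    proof
      fix z assume z: "z \<in> path_image (c e) \<inter> path_image (c e')"
      have "p ` e \<noteq> p ` e'"
        using inj_on_image_eq_iff[OF inj e(4)[OF E] e(4)[OF E'(1)]] E'(2) by simp
      then have ne: "(lo e, hi e) \<noteq> (lo e', hi e')"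
        using e(2)[OF E] e(2)[OF E'(1)] by auto
      have nc: "\<not> (lo e < lo e' \<and> lo e' < hi e \<and> hi e < hi e') \<and>
          \<not> (lo e' < lo e \<and> lo e < hi e' \<and> hi e' < hi e)" if "s e = s e'"
      proof (cases "U (lo e) (hi e)")
        case True
        then have "U (lo e') (hi e')"
          using that unfolding s_def by (auto split: if_splits)
        with True U show ?thesis unfolding noncrossing_def by blast
      next
        case False
        then have "\<not> U (lo e') (hi e')"
          using that unfolding s_def by (auto split: if_splits)
        with False L e(3)[OF E] e(3)[OF E'(1)] show ?thesis unfolding noncrossing_def by blast
      qed
      have "Im z = 0 \<and> Re z \<in> {lo e, hi e} \<and> Re z \<in> {lo e', hi e'}"
        by (rule lobes_Int[of z "s e" _ _ "s e'"])
          (use z ne nc e(1)[OF E] e(1)[OF E'(1)] in \<open>auto simp: c_def s_def\<close>)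
      then have "z \<in> pos ` e" "z \<in> pos ` e'"
        unfolding pos_e[OF E] pos_e[OF E'(1)] by (auto simp: complex_eq_iff)
      then obtain v v' where v: "v \<in> e" "v' \<in> e'" "z = pos v" "z = pos v'" by blast
      then have "p v = p v'" unfolding pos_def by simp
      then have "v = v'"
        using inj v e(4)[OF E] e(4)[OF E'(1)] by (meson inj_onD subsetD)
      with v show "z \<in> pos ` (e \<inter> e')" by blast
    qed
  qed
qed

subsection \<open>The layers\<close>

text \<open>By the Chinese remainder theorem \<open>K\<^bsub>n,n,n\<^esub> \<times> K\<^sub>2\<close> is a 6-cycle in which every vertex is replaced
  by \<open>n\<close> copies; \<open>vx q a\<close> is the copy number \<open>a\<close> of the vertex \<open>q\<close> of the cycle.\<close>

definition vx :: "nat \<Rightarrow> nat \<Rightarrow> (nat \<times> nat) \<times> nat" where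
  "vx q a = ((q mod 3, a), q mod 2)"

definition nxt :: "nat \<Rightarrow> nat" where
  "nxt q = (if q = 5 then 0 else q + 1)"

definition cyc_edge :: "nat \<Rightarrow> nat \<Rightarrow> nat \<Rightarrow> ((nat \<times> nat) \<times> nat) set" where
  "cyc_edge q a b = {vx q a, vx (nxt q) b}"

lemma less_6_cases: "q < 6 \<Longrightarrow> q = 0 \<or> q = 1 \<or> q = 2 \<or> q = 3 \<or> q = 4 \<or> q = (5::nat)"
  by linarith

lemma vx_inject:
  assumes "q < 6" "q' < 6"
  shows "vx q a = vx q' a' \<longleftrightarrow> q = q' \<and> a = a'"
  using less_6_cases[OF assms(1)] less_6_cases[OF assms(2)] unfolding vx_def
  by (elim disjE) simp_all

lemma nxt_less: "q < 6 \<Longrightarrow> nxt q < 6"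
  by (auto simp: nxt_def)

text \<open>The witness works because 4 is 1 modulo 3 and 0 modulo 2, while 3 is 0 modulo 3 and 1
  modulo 2.\<close>

lemma crt_6:
  fixes i h :: nat
  assumes "i < 3" "h < 2"
  obtains q where "q < 6" "i = q mod 3" "h = q mod 2"
proof
  show "(4 * i + 3 * h) mod 6 < 6" by simp
  have "i = 0 \<or> i = 1 \<or> i = 2" "h = 0 \<or> h = 1"
    using assms by linarith+
  then show "i = (4 * i + 3 * h) mod 6 mod 3" "h = (4 * i + 3 * h) mod 6 mod 2"
    by auto
qed

text \<open>The difference of \<open>q\<close> and \<open>q'\<close> is divisible by neither 2 nor
  3, hence is 1 or -1 modulo 6.\<close>

lemma nxt_cases:
  assumes "q < 6" "q' < 6" "q mod 3 \<noteq> q' mod 3" "q mod 2 \<noteq> q' mod 2"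
  shows "q' = nxt q \<or> q = nxt q'"
  using less_6_cases[OF assms(1)] less_6_cases[OF assms(2)] assms(3,4)
  by (elim disjE) (simp_all add: nxt_def)

lemma vertices_eq: "fst (kron (K_nnn n) K2) = {vx q a | q a. q < 6 \<and> a < n}"
proof (intro equalityI subsetI)
  fix v assume "v \<in> fst (kron (K_nnn n) K2)"
  then obtain i a h where v: "v = ((i, a), h)" "i < 3" "a < n" "h < 2"
    unfolding kron_def K_nnn_def K2_def by auto
  then show "v \<in> {vx q a | q a. q < 6 \<and> a < n}"
    using crt_6[OF v(2,4)] unfolding vx_def by blast
qed (auto simp: kron_def K_nnn_def K2_def vx_def)

lemma mem_edges_iff:
  "e \<in> snd (kron (K_nnn n) K2) \<longleftrightarrow> (\<exists>i a j b h h'. e = {((i, a), h), ((j, b), h')} \<and>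
     i < 3 \<and> j < 3 \<and> i \<noteq> j \<and> a < n \<and> b < n \<and> h < 2 \<and> h' < 2 \<and> h \<noteq> h')" (is "?l = ?r")
proof
  assume ?l
  then obtain g h g' h' i a j b where e: "e = {(g, h), (g', h')}" "{g, g'} = {(i, a), (j, b)}"
      "{h, h'} = {0::nat, 1}" "i < 3" "j < 3" "a < n" "b < n" "i \<noteq> j"
    unfolding kron_def K_nnn_def K2_def by auto
  then have h: "h < 2" "h' < 2" "h \<noteq> h'"
    by (auto simp: doubleton_eq_iff)
  from e(2) consider "g = (i, a)" "g' = (j, b)" | "g = (j, b)" "g' = (i, a)"
    by (auto simp: doubleton_eq_iff)
  then show ?r
    using e(1,4-8) h by cases metis+
next
  assume ?r
  then obtain i a j b h h' where e: "e = {((i, a), h), ((j, b), h')}" "i < 3" "j < 3" "i \<noteq> j"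
     "a < n" "b < n" "h < 2" "h' < 2" "h \<noteq> h'" by blast
  have "{h, h'} = {0, 1}"
    using e(7-9) by (auto simp: less_2_cases_iff)
  then have "{h, h'} \<in> snd K2" "{(i, a), (j, b)} \<in> snd (K_nnn n)"
    unfolding K2_def K_nnn_def snd_conv using e by blast+
  then show ?l
    unfolding kron_def snd_conv e(1) by blast
qed

lemma edges_eq: "snd (kron (K_nnn n) K2) = {cyc_edge q a b | q a b. q < 6 \<and> a < n \<and> b < n}"
proof (intro equalityI subsetI)
  fix e assume "e \<in> {cyc_edge q a b | q a b. q < 6 \<and> a < n \<and> b < n}"
  then obtain q a b where q: "q < 6" "a < n" "b < n" "e = cyc_edge q a b" by blast
  have "q mod 3 \<noteq> nxt q mod 3" "q mod 2 \<noteq> nxt q mod 2"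
    using less_6_cases[OF q(1)] by (auto simp: nxt_def)
  moreover have "q mod 3 < 3" "nxt q mod 3 < 3" "q mod 2 < 2" "nxt q mod 2 < 2"
    by simp_all
  ultimately show "e \<in> snd (kron (K_nnn n) K2)"
    unfolding mem_edges_iff using q unfolding cyc_edge_def vx_def by metis
next
  fix e assume "e \<in> snd (kron (K_nnn n) K2)"
  then obtain i a j b h h' where e: "e = {((i, a), h), ((j, b), h')}" "i < 3" "j < 3" "i \<noteq> j"
     "a < n" "b < n" "h < 2" "h' < 2" "h \<noteq> h'"
    unfolding mem_edges_iff by blast
  obtain q where q: "q < 6" "i = q mod 3" "h = q mod 2" using crt_6 e by blast
  obtain q' where q': "q' < 6" "j = q' mod 3" "h' = q' mod 2" using crt_6 e by blast
  have eq: "e = {vx q a, vx q' b}"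
    unfolding e(1) vx_def q q' ..
  have "q' = nxt q \<or> q = nxt q'"
    using nxt_cases[OF q(1) q'(1)] e q q' by simp
  then have "e = cyc_edge q a b \<or> e = cyc_edge q' b a"
    unfolding eq cyc_edge_def by (auto simp: insert_commute)
  then show "e \<in> {cyc_edge q a b | q a b. q < 6 \<and> a < n \<and> b < n}"
    using q(1) q'(1) e by blast
qed

section \<open>The layers as book embeddings\<close>

text \<open>This reduces planarity of a layer to real intervals: \<open>F q a\<close> is the
  position of copy \<open>a\<close> of \<open>q\<close> on the spine, and \<open>S\<close> selects
  the copies joined in the layer.\<close>

lemma planar_cyclic_book:
  fixes F :: "nat \<Rightarrow> nat \<Rightarrow> real"
  assumes inj: "\<And>q a q' a'. q < 6 \<Longrightarrow> q' < 6 \<Longrightarrow> a < n \<Longrightarrow> a' < n \<Longrightarrow> F q a = F q' a' \<Longrightarrow> q = q' \<and> a = a'"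
    and edges: "\<And>q a b. q < 6 \<Longrightarrow> a < n \<Longrightarrow> b < n \<Longrightarrow> S a b \<Longrightarrow>
      \<exists>l h. l < h \<and> {F q a, F (nxt q) b} = {l, h} \<and> (U l h \<or> L l h)"
    and U: "noncrossing U" and L: "noncrossing L"
  shows "planar (fst (kron (K_nnn n) K2), {cyc_edge q a b | q a b. q < 6 \<and> a < n \<and> b < n \<and> S a b})"
proof (rule planar_two_page_book[OF _ _ U L])
  define p where "p = (\<lambda>((i, a), h). F ((4 * i + 3 * h) mod 6) a)"
  have p: "p (vx q a) = F q a" if "q < 6" for q a
    using less_6_cases[OF that] unfolding p_def vx_def by auto
  show "inj_on p (fst (kron (K_nnn n) K2))"
  proof (rule inj_onI)
    fix v v' assume "v \<in> fst (kron (K_nnn n) K2)" "v' \<in> fst (kron (K_nnn n) K2)" and eq: "p v = p v'"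
    then obtain q a q' a' where v: "v = vx q a" "q < 6" "a < n" "v' = vx q' a'" "q' < 6" "a' < n"
      unfolding vertices_eq by blast
    then have "F q a = F q' a'" using eq p by simp
    then show "v = v'" using inj v by blast
  qed
  fix e assume "e \<in> {cyc_edge q a b | q a b. q < 6 \<and> a < n \<and> b < n \<and> S a b}"
  then obtain q a b where e: "e = cyc_edge q a b" "q < 6" "a < n" "b < n" "S a b" by blast
  then have "p ` e = {F q a, F (nxt q) b}"
    by (simp add: cyc_edge_def p nxt_less)
  moreover have "e \<subseteq> fst (kron (K_nnn n) K2)"
    unfolding vertices_eq e(1) cyc_edge_def using e nxt_less by blast
  ultimately show "e \<subseteq> fst (kron (K_nnn n) K2) \<and>
      (\<exists>l h. l < h \<and> p ` e = {l, h} \<and> (U l h \<or> L l h))"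
    using edges[OF e(2-5)] by simp
qed

text \<open>Here \<open>a\<close> is a copy of \<open>q\<close> and \<open>b\<close> a copy of its
  successor. With \<open>m = n div 2\<close> and \<open>n\<close> odd, the unpaired copy
  \<open>b = 2 * m\<close> falls into layer \<open>m\<close> by the division.\<close>

definition layer :: "nat \<Rightarrow> nat \<Rightarrow> nat \<Rightarrow> nat" where
  "layer m a b = (if even b \<and> a = b + 1 then m else b div 2)"

lemma nat_plus_frac_inject:
  fixes x y :: real
  assumes "real m + x = real n + y" "0 \<le> x" "x < 1" "0 \<le> y" "y < 1"
  shows "m = n \<and> x = y"
proof -
  have "real m < real n + 1" "real n < real m + 1"
    using assms by linarith+
  then have "m = n" by linarith
  with assms show ?thesis by simp
qed

text \<open>This passes the integrality of block numbers to real linear arithmetic, which then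
  settles the crossing cases.\<close>

lemma real_nat_trichotomy:
  "real k + 1 \<le> real k' \<or> real k = real k' \<or> real k' + 1 \<le> real k"
  by (cases k k' rule: linorder_cases) (simp_all add: nat_less_real_le)

text \<open>Copy \<open>2 r\<close> of \<open>q\<close> is placed at \<open>q\<close>, copy \<open>2 r + 1\<close> of \<open>q + 1\<close> at \<open>q + 1 / 4\<close>, and the other
  copies of \<open>q\<close> between \<open>q + 1 / 2\<close> and \<open>q + 1\<close>.\<close>

lemma planar_layer_main:
  assumes "r < m"
  shows "planar (fst (kron (K_nnn n) K2), {cyc_edge q a b | q a b. q < 6 \<and> a < n \<and> b < n \<and> layer m a b = r})"
proof -
  define t where "t a = 1 / 2 + 1 / (real a + 3)" for a
  define fr where "fr a = (if a = 2 * r then 0 else if a = 2 * r + 1 then 1 / 4 else t a)" for a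
  define bl where "bl q a = (if a = 2 * r + 1 then (if q = 0 then 5 else q - 1) else q)" for q a :: nat
  define F where "F q a = real (bl q a) + fr a" for q a
  \<comment> \<open>In order: the cycle through the copies \<open>2 * r\<close> and its closing
    edge, the edges from copy \<open>2 * r\<close> of \<open>q\<close> to copy
    \<open>2 * r + 1\<close> of \<open>q + 1\<close>, and the edges from the latter to the other
    copies of \<open>q\<close>.\<close>
  define U where "U l h \<longleftrightarrow> (\<exists>k. (l = real k \<and> h = real k + 1) \<or> (l = 0 \<and> h = 5) \<or>
      (l = real k \<and> h = real k + 1 / 4) \<or> (\<exists>u. 1 / 2 < u \<and> u < 1 \<and> l = real k + 1 / 4 \<and> h = real k + u))"
    for l h
  \<comment> \<open>The cycle through the copies \<open>2 * r + 1\<close>, and the edges from the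
    other copies of \<open>q\<close> to copy \<open>2 * r\<close> of \<open>q + 1\<close>. The bound
    on \<open>k\<close> matters: a pair starting inside block 5 and ending beyond it could cross a
    closing pair from 0 to \<open>5 + u\<close>.\<close>
  define L where "L l h \<longleftrightarrow> (\<exists>k. real k \<le> 4 \<and> ((l = real k + 1 / 4 \<and> h = real k + 5 / 4) \<or> (l = 1 / 4 \<and> h = 5 + 1 / 4) \<or>
      (\<exists>u. 1 / 2 < u \<and> u < 1 \<and> (l = real k + u \<and> h = real k + 1 \<or> l = 0 \<and> h = 5 + u))))"
    for l h
  have t: "1 / 2 < t a" "t a < 1" for a
    unfolding t_def by (auto simp: field_simps)
  have t_inj: "t a = t b \<Longrightarrow> a = b" for a b
    unfolding t_def by (simp add: field_simps)
  have fr: "0 \<le> fr a" "fr a < 1" for a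
    unfolding fr_def using t[of a] by auto
  have fr_inj: "a = b" if "fr a = fr b" for a b
    using that t[of a] t[of b] t_inj[of a b] unfolding fr_def by (auto split: if_splits)
  show ?thesis
  proof (rule planar_cyclic_book[where F = F and U = U and L = L])
    fix q a q' a' assume q: "q < (6::nat)" "q' < 6" "F q a = F q' a'"
    then have "bl q a = bl q' a'" "fr a = fr a'"
      using nat_plus_frac_inject fr unfolding F_def by blast+
    with q fr_inj show "q = q' \<and> a = a'"
      unfolding bl_def by (auto split: if_splits)
  next
    show "noncrossing U"
      unfolding noncrossing_def
    proof (intro allI impI notI)
      fix l h l' h' assume "U l h" "U l' h'" and x: "l < l' \<and> l' < h \<and> h < h'"
      from this(1,2) obtain k k' where
        "(l = real k \<and> h = real k + 1) \<or> (l = 0 \<and> h = 5) \<or> (l = real k \<and> h = real k + 1 / 4) \<or>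
          (\<exists>u. 1 / 2 < u \<and> u < 1 \<and> l = real k + 1 / 4 \<and> h = real k + u)"
        "(l' = real k' \<and> h' = real k' + 1) \<or> (l' = 0 \<and> h' = 5) \<or> (l' = real k' \<and> h' = real k' + 1 / 4) \<or>
          (\<exists>u. 1 / 2 < u \<and> u < 1 \<and> l' = real k' + 1 / 4 \<and> h' = real k' + u)"
        unfolding U_def by blast
      moreover have "0 \<le> real k" "0 \<le> real k'" by simp_all
      moreover have "real k + 1 \<le> 5 \<or> 5 \<le> real k" "real k' + 1 \<le> 5 \<or> 5 \<le> real k'"
        using real_nat_trichotomy[of k 5] real_nat_trichotomy[of k' 5] by auto
      ultimately show False
        using x real_nat_trichotomy[of k k'] by (elim disjE exE conjE; linarith)
    qed
    show "noncrossing L"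
      unfolding noncrossing_def
    proof (intro allI impI notI)
      fix l h l' h' assume "L l h" "L l' h'" and x: "l < l' \<and> l' < h \<and> h < h'"
      from this(1,2) obtain k k' where "real k \<le> 4" "real k' \<le> 4"
        "(l = real k + 1 / 4 \<and> h = real k + 5 / 4) \<or> (l = 1 / 4 \<and> h = 5 + 1 / 4) \<or>
          (\<exists>u. 1 / 2 < u \<and> u < 1 \<and> (l = real k + u \<and> h = real k + 1 \<or> l = 0 \<and> h = 5 + u))"
        "(l' = real k' + 1 / 4 \<and> h' = real k' + 5 / 4) \<or> (l' = 1 / 4 \<and> h' = 5 + 1 / 4) \<or>
          (\<exists>u. 1 / 2 < u \<and> u < 1 \<and> (l' = real k' + u \<and> h' = real k' + 1 \<or> l' = 0 \<and> h' = 5 + u))"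
        unfolding L_def by blast
      moreover have "0 \<le> real k" "0 \<le> real k'" by simp_all
      ultimately show False
        using x real_nat_trichotomy[of k k'] by (elim disjE exE conjE; linarith)
    qed
  next
    fix q a b :: nat assume q: "q < 6" "a < n" "b < n" "layer m a b = r"
    \<comment> \<open>Since \<open>r < m\<close>, the edge with \<open>a = 2 * r + 1\<close> and
      \<open>b = 2 * r\<close> is absent: \<open>layer\<close> sends it to \<open>m\<close>.\<close>
    have "b = 2 * r \<and> a \<noteq> 2 * r + 1 \<or> b = 2 * r + 1"
      using q(4) assms unfolding layer_def by (auto split: if_splits elim: oddE)
    then consider "b = 2 * r" "a = 2 * r" | "b = 2 * r" "a \<noteq> 2 * r" "a \<noteq> 2 * r + 1"
      | "b = 2 * r + 1" "a = 2 * r" | "b = 2 * r + 1" "a = 2 * r + 1"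
      | "b = 2 * r + 1" "a \<noteq> 2 * r" "a \<noteq> 2 * r + 1"
      by blast
    then show "\<exists>l h. l < h \<and> {F q a, F (nxt q) b} = {l, h} \<and> (U l h \<or> L l h)"
    proof cases
      case 1
      show ?thesis
      proof (cases "q = 5")
        case True
        with 1 have "{F q a, F (nxt q) b} = {0, 5}" "U 0 5"
          unfolding F_def bl_def fr_def nxt_def U_def by auto
        then show ?thesis by (intro exI[of _ 0] exI[of _ 5]) simp
      next
        case False
        with 1 have "{F q a, F (nxt q) b} = {real q, real q + 1}" "U (real q) (real q + 1)"
          unfolding F_def bl_def fr_def nxt_def U_def by auto
        then show ?thesis by (intro exI[of _ "real q"] exI[of _ "real q + 1"]) simp
      qed
    next
      case 2
      show ?thesis
      proof (cases "q = 5")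
        case True
        with 2 have "{F q a, F (nxt q) b} = {0, 5 + t a}" "L 0 (5 + t a)"
          unfolding F_def bl_def fr_def nxt_def L_def using t[of a] by auto
        then show ?thesis using t[of a] by (intro exI[of _ 0] exI[of _ "5 + t a"]) simp
      next
        case False
        with 2 have "{F q a, F (nxt q) b} = {real q + t a, real q + 1}"
          unfolding F_def bl_def fr_def nxt_def by auto
        moreover have "L (real q + t a) (real q + 1)"
          using False q(1) t[of a] unfolding L_def
          by (intro exI[of _ q] conjI disjI2 exI[of _ "t a"] disjI1) auto
        ultimately show ?thesis
          using t[of a] by (intro exI[of _ "real q + t a"] exI[of _ "real q + 1"]) simp
      qed
    next
      case 3
      with q have "{F q a, F (nxt q) b} = {real q, real q + 1 / 4}" "U (real q) (real q + 1 / 4)"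
        unfolding F_def bl_def fr_def nxt_def U_def by auto
      then show ?thesis by (intro exI[of _ "real q"] exI[of _ "real q + 1 / 4"]) simp
    next
      case 4
      show ?thesis
      \<comment> \<open>Copies \<open>2 * r + 1\<close> sit one block earlier, so their cycle wraps
        around at \<open>q = 0\<close> instead of \<open>q = 5\<close>.\<close>
      proof (cases q)
        case 0
        with 4 have "{F q a, F (nxt q) b} = {1 / 4, 5 + 1 / 4}" "L (1 / 4) (5 + 1 / 4)"
          unfolding F_def bl_def fr_def nxt_def L_def by auto
        then show ?thesis by (intro exI[of _ "1 / 4"] exI[of _ "5 + 1 / 4"]) simp
      next
        case (Suc k)
        with 4 have "{F q a, F (nxt q) b} = {real k + 1 / 4, real k + 5 / 4}"
          unfolding F_def bl_def fr_def nxt_def by auto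
        moreover have "L (real k + 1 / 4) (real k + 5 / 4)"
          using Suc q(1) unfolding L_def by (intro exI[of _ k]) auto
        ultimately show ?thesis
          by (intro exI[of _ "real k + 1 / 4"] exI[of _ "real k + 5 / 4"]) simp
      qed
    next
      case 5
      with q have "{F q a, F (nxt q) b} = {real q + 1 / 4, real q + t a}"
        unfolding F_def bl_def fr_def nxt_def by auto
      moreover have "U (real q + 1 / 4) (real q + t a)"
        using t[of a] unfolding U_def by (intro exI[of _ q] disjI2 exI[of _ "t a"]) auto
      ultimately show ?thesis
        using t[of a] by (intro exI[of _ "real q + 1 / 4"] exI[of _ "real q + t a"]) simp
    qed
  qed
qed

text \<open>Copy \<open>2 m\<close> of \<open>q\<close> is placed at \<open>q\<close>. It is followed by pairs consisting of copy \<open>2 s + 1\<close> of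
  \<open>q - 1\<close> and copy \<open>2 s\<close> of \<open>q\<close>, the inner vertices of a path from copy \<open>2 m\<close> of \<open>q\<close> to that of \<open>q + 1\<close>.\<close>

lemma planar_layer_last:
  assumes m: "m = n div 2"
  shows "planar (fst (kron (K_nnn n) K2), {cyc_edge q a b | q a b. q < 6 \<and> a < n \<and> b < n \<and> layer m a b = m})"
proof -
  \<comment> \<open>The slots increase strictly inside the unit interval. In \<open>fr\<close>, copy
    \<open>2 * s + 1\<close> takes slot \<open>2 * s\<close> and copy \<open>2 * s\<close> takes
    slot \<open>2 * s + 1\<close>, so the odd copy comes first.\<close>
  define t where "t j = (real j + 1) / (real j + 2)" for j :: nat
  define fr where "fr a = (if a = 2 * m then 0 else if even a then t (a + 1) else t (a - 1))" for a
  define bl where "bl q a = (if even a then q else nxt q)" for q a :: nat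
  define F where "F q a = real (bl q a) + fr a" for q a
  define U where "U l h \<longleftrightarrow> (\<exists>k s. (l = real k \<and> h = real k + 1) \<or> (l = 0 \<and> h = 5) \<or>
      (l = real k \<and> h = real k + t (2 * s)) \<or> (l = real k + t (2 * s) \<and> h = real k + t (2 * s + 1)))"
    for l h
  define L where "L l h \<longleftrightarrow> (\<exists>k u. real k \<le> 4 \<and> 0 < u \<and> u < 1 \<and>
      (l = real k + u \<and> h = real k + 1 \<or> l = 0 \<and> h = 5 + u))"
    for l h
  have t: "0 < t j" "t j < 1" for j
    unfolding t_def by (auto simp: field_simps)
  have t_less: "t i < t j \<longleftrightarrow> i < j" for i j
  proof -
    have "t i < t j \<longleftrightarrow> real i < real j"
      unfolding t_def by (simp add: field_simps)
    then show ?thesis by simp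
  qed
  have t_inj: "t i = t j \<Longrightarrow> i = j" for i j
    using t_less by (metis linorder_neqE_nat order_less_irrefl)
  have fr: "0 \<le> fr a" "fr a < 1" for a
    unfolding fr_def using t[of "a + 1"] t[of "a - 1"] by auto
  have fr_inj: "a = b" if "fr a = fr b" for a b
  proof -
    define j where "j a = (if even a then a + 1 else a - 1)" for a :: nat
    have fr_j: "fr a = (if a = 2 * m then 0 else t (j a))" for a
      unfolding fr_def j_def by simp
    have "j a = j b \<Longrightarrow> a = b"
      unfolding j_def by presburger
    then show ?thesis
      using that t_inj[of "j a" "j b"] t(1)[of "j a"] t(1)[of "j b"] unfolding fr_j by (auto split: if_splits)
  qed
  show ?thesis
  proof (rule planar_cyclic_book[where F = F and U = U and L = L])
    fix q a q' a' assume q: "q < (6::nat)" "q' < 6" "F q a = F q' a'"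
    then have "bl q a = bl q' a'" "fr a = fr a'"
      using nat_plus_frac_inject fr unfolding F_def by blast+
    with q fr_inj show "q = q' \<and> a = a'"
      unfolding bl_def nxt_def by (auto split: if_splits)
  next
    show "noncrossing U"
      unfolding noncrossing_def
    proof (intro allI impI notI)
      fix l h l' h' assume "U l h" "U l' h'" and x: "l < l' \<and> l' < h \<and> h < h'"
      from this(1,2) obtain k s k' s' where
        "(l = real k \<and> h = real k + 1) \<or> (l = 0 \<and> h = 5) \<or> (l = real k \<and> h = real k + t (2 * s)) \<or>
          (l = real k + t (2 * s) \<and> h = real k + t (2 * s + 1))"
        "(l' = real k' \<and> h' = real k' + 1) \<or> (l' = 0 \<and> h' = 5) \<or> (l' = real k' \<and> h' = real k' + t (2 * s')) \<or>
          (l' = real k' + t (2 * s') \<and> h' = real k' + t (2 * s' + 1))"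
        unfolding U_def by blast
      moreover have "0 \<le> real k" "0 \<le> real k'" by simp_all
      \<comment> \<open>The slot intervals of two pairs are equal or do not overlap.\<close>
      moreover have "t (2 * s) = t (2 * s') \<and> t (2 * s + 1) = t (2 * s' + 1) \<or>
          t (2 * s + 1) \<le> t (2 * s') \<or> t (2 * s' + 1) \<le> t (2 * s)"
      proof (cases "s = s'")
        case False
        then show ?thesis
          using t_less[of "2 * s'" "2 * s + 1"] t_less[of "2 * s" "2 * s' + 1"] by linarith
      qed simp
      moreover have "t (2 * s) < t (2 * s + 1)" "t (2 * s') < t (2 * s' + 1)"
        by (simp_all add: t_less)
      moreover note t[of "2 * s"] t[of "2 * s + 1"] t[of "2 * s'"] t[of "2 * s' + 1"]
      moreover have "real k + 1 \<le> 5 \<or> 5 \<le> real k" "real k' + 1 \<le> 5 \<or> 5 \<le> real k'"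
        using real_nat_trichotomy[of k 5] real_nat_trichotomy[of k' 5] by auto
      ultimately show False
        using x real_nat_trichotomy[of k k'] by (elim disjE exE conjE; linarith)
    qed
    show "noncrossing L"
      unfolding noncrossing_def
    proof (intro allI impI notI)
      fix l h l' h' assume "L l h" "L l' h'" and x: "l < l' \<and> l' < h \<and> h < h'"
      from this(1,2) obtain k u k' u' where "real k \<le> 4" "real k' \<le> 4" "0 < u" "u < 1" "0 < u'" "u' < 1"
        "l = real k + u \<and> h = real k + 1 \<or> l = 0 \<and> h = 5 + u"
        "l' = real k' + u' \<and> h' = real k' + 1 \<or> l' = 0 \<and> h' = 5 + u'"
        unfolding L_def by blast
      moreover have "0 \<le> real k" "0 \<le> real k'" by simp_all
      ultimately show False
        using x real_nat_trichotomy[of k k'] by (elim disjE exE conjE; linarith)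
    qed
  next
    fix q a b :: nat assume q: "q < 6" "a < n" "b < n" "layer m a b = m"
    have "a \<le> 2 * m" "b \<le> 2 * m"
      using q m by linarith+
    then have "b = 2 * m \<or> b div 2 < m"
      by linarith
    \<comment> \<open>Either \<open>b\<close> is the unpaired copy, possible only for odd
      \<open>n\<close>, or the edge is one of the exceptional edges.\<close>
    then have "b = 2 * m \<or> (\<exists>s<m. b = 2 * s \<and> a = 2 * s + 1)"
      using q(4) unfolding layer_def by (auto split: if_splits elim!: evenE)
    moreover have "even a \<or> (\<exists>s. a = 2 * s + 1)"
      using oddE by blast
    ultimately consider "b = 2 * m" "a = 2 * m" | "b = 2 * m" "a \<noteq> 2 * m" "even a"
      | s where "b = 2 * m" "a = 2 * s + 1" | s where "b = 2 * s" "a = 2 * s + 1" "s < m"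
      by blast
    then show "\<exists>l h. l < h \<and> {F q a, F (nxt q) b} = {l, h} \<and> (U l h \<or> L l h)"
    proof cases
      case 1
      show ?thesis
      proof (cases "q = 5")
        case True
        with 1 have "{F q a, F (nxt q) b} = {0, 5}" "U 0 5"
          unfolding F_def bl_def fr_def nxt_def U_def by auto
        then show ?thesis by (intro exI[of _ 0] exI[of _ 5]) simp
      next
        case False
        with 1 have "{F q a, F (nxt q) b} = {real q, real q + 1}" "U (real q) (real q + 1)"
          unfolding F_def bl_def fr_def nxt_def U_def by auto
        then show ?thesis by (intro exI[of _ "real q"] exI[of _ "real q + 1"]) simp
      qed
    next
      case 2
      let ?u = "t (a + 1)"
      show ?thesis
      proof (cases "q = 5")
        case True
        with 2 have "{F q a, F (nxt q) b} = {0, 5 + ?u}"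
          unfolding F_def bl_def fr_def nxt_def by auto
        moreover have "L 0 (5 + ?u)"
          unfolding L_def using t[of "a + 1"] by (intro exI[of _ 0] exI[of _ ?u]) auto
        ultimately show ?thesis using t[of "a + 1"] by (intro exI[of _ 0] exI[of _ "5 + ?u"]) simp
      next
        case False
        with 2 have "{F q a, F (nxt q) b} = {real q + ?u, real q + 1}"
          unfolding F_def bl_def fr_def nxt_def by auto
        moreover have "L (real q + ?u) (real q + 1)"
          using False q(1) t[of "a + 1"] unfolding L_def by (intro exI[of _ q] exI[of _ ?u]) auto
        ultimately show ?thesis
          using t[of "a + 1"] by (intro exI[of _ "real q + ?u"] exI[of _ "real q + 1"]) simp
      qed
    next
      case (3 s)
      let ?k = "real (nxt q)"
      have "a \<noteq> 2 * m" using 3 by presburger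
      with 3 have "{F q a, F (nxt q) b} = {?k, ?k + t (2 * s)}"
        unfolding F_def bl_def fr_def by auto
      moreover have "U ?k (?k + t (2 * s))"
        unfolding U_def by blast
      ultimately show ?thesis
        using t[of "2 * s"] by (intro exI[of _ ?k] exI[of _ "?k + t (2 * s)"]) simp
    next
      case (4 s)
      let ?k = "real (nxt q)"
      have "a \<noteq> 2 * m" "b \<noteq> 2 * m" using 4 by presburger+
      with 4 have "{F q a, F (nxt q) b} = {?k + t (2 * s), ?k + t (2 * s + 1)}"
        unfolding F_def bl_def fr_def by auto
      moreover have "U (?k + t (2 * s)) (?k + t (2 * s + 1))"
        unfolding U_def by blast
      ultimately show ?thesis
        using t_less[of "2 * s" "2 * s + 1"]
        by (intro exI[of _ "?k + t (2 * s)"] exI[of _ "?k + t (2 * s + 1)"]) simp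
    qed
  qed
qed

section \<open>Edge counting and the value of the thickness\<close>

text \<open>No two vertices of the 6-cycle are successors of each other, so an edge determines its
  direction along the cycle.\<close>

lemma inj_on_cyc_edge: "inj_on (\<lambda>(q, a, b). cyc_edge q a b) ({..<6} \<times> {..<n} \<times> {..<n})"
proof -
  have "q = q' \<and> a = a' \<and> b = b'"
    if q: "q < 6" "q' < 6" and eq: "cyc_edge q a b = cyc_edge q' a' b'" for q a b q' a' b'
  proof -
    have "\<not> (q = nxt q' \<and> nxt q = q')"
      using q unfolding nxt_def by auto
    then show ?thesis
      using eq unfolding cyc_edge_def doubleton_eq_iff vx_inject[OF q(1) q(2)]
        vx_inject[OF q(1) nxt_less[OF q(2)]] vx_inject[OF nxt_less[OF q(1)] q(2)]
        vx_inject[OF nxt_less[OF q(1)] nxt_less[OF q(2)]] by blast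
  qed
  then show ?thesis
    unfolding inj_on_def by fastforce
qed

lemma card_edges: "card (snd (kron (K_nnn n) K2)) = 6 * n ^ 2"
proof -
  have "snd (kron (K_nnn n) K2) = (\<lambda>(q, a, b). cyc_edge q a b) ` ({..<6} \<times> {..<n} \<times> {..<n})"
    unfolding edges_eq by force
  then show ?thesis
    using card_image[OF inj_on_cyc_edge] by (simp add: card_cartesian_product power2_eq_square)
qed

lemma card_vertices: "card (fst (kron (K_nnn n) K2)) = 6 * n"
  unfolding kron_def K_nnn_def K2_def by (simp add: card_cartesian_product)

lemma thickness_lower:
  assumes n: "n \<ge> 1"
    and F: "\<forall>i<k. F i \<subseteq> snd (kron (K_nnn n) K2) \<and> planar (fst (kron (K_nnn n) K2), F i)"
    and cover: "(\<Union>i<k. F i) = snd (kron (K_nnn n) K2)"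
  shows "n div 2 + 1 \<le> k"
proof (rule ccontr)
  assume "\<not> n div 2 + 1 \<le> k"
  then have k: "2 * k \<le> n" by linarith
  let ?V = "fst (kron (K_nnn n) K2)"
  have V: "finite ?V" "?V \<noteq> {}"
    using card_vertices[of n] n by (auto intro!: card_ge_0_finite)
  have bound: "card (F i) + 2 \<le> 12 * n" if "i < k" for i
  proof -
    have "card (F i) + 2 \<le> 2 * card ?V"
    \<comment> \<open>The coordinate in \<open>K2\<close> is the bipartition.\<close>
    proof (rule planar_bipartite_edge_bound[where side = "\<lambda>v. snd v = 0"])
      show "planar (?V, F i)" using F that by blast
      fix e assume "e \<in> F i"
      then have "e \<in> snd (kron (K_nnn n) K2)" using F that by blast
      then obtain q a b where e: "e = {vx q a, vx (nxt q) b}" "q < 6" "a < n" "b < n"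
        unfolding edges_eq cyc_edge_def by blast
      then have "e \<subseteq> ?V"
        unfolding vertices_eq using nxt_less by blast
      moreover have "snd (vx q a) = 0 \<longleftrightarrow> snd (vx (nxt q) b) \<noteq> 0"
        using less_6_cases[OF e(2)] unfolding vx_def nxt_def by auto
      ultimately show "e \<subseteq> ?V \<and> (\<exists>x y. e = {x, y} \<and> snd x = 0 \<and> snd y \<noteq> 0)"
        using e(1) by (metis insert_commute)
    qed (use V in auto)
    then show ?thesis by (simp add: card_vertices)
  qed
  have "6 * n ^ 2 = card (\<Union>i<k. F i)"
    using cover card_edges by simp
  also have "\<dots> \<le> (\<Sum>i<k. card (F i))"
    by (rule card_UN_le) simp
  finally have "6 * n ^ 2 + 2 * k \<le> (\<Sum>i<k. card (F i) + 2)"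
    unfolding sum.distrib by simp
  also have "\<dots> \<le> (\<Sum>i<k. 12 * n)"
    using bound by (intro sum_mono) auto
  also have "\<dots> = 6 * n * (2 * k)" by simp
  also have "\<dots> \<le> 6 * n * n"
    using k by (intro mult_le_mono) auto
  \<comment> \<open>The summand \<open>2 * k\<close> is the slack in the edge bounds; it must
    vanish, and zero layers cannot cover the nonempty edge set.\<close>
  finally have "k = 0" by (simp add: power2_eq_square)
  then show False
    using cover card_edges[of n] n by simp
qed

text \<open>The fibres of \<open>layer\<close> partition the edges, and its values are at most
  \<open>n div 2\<close>.\<close>

lemma thickness_upper:
  "\<exists>F. (\<forall>i<n div 2 + 1. F i \<subseteq> snd (kron (K_nnn n) K2) \<and> planar (fst (kron (K_nnn n) K2), F i)) \<and>
    (\<Union>i<n div 2 + 1. F i) = snd (kron (K_nnn n) K2)"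
proof -
  define F where "F r = {cyc_edge q a b | q a b. q < 6 \<and> a < n \<and> b < n \<and> layer (n div 2) a b = r}" for r
  have "planar (fst (kron (K_nnn n) K2), F r)" if "r < n div 2 + 1" for r
  proof (cases "r = n div 2")
    case True
    then show ?thesis unfolding F_def using planar_layer_last[of "n div 2" n] by simp
  next
    case False
    then show ?thesis unfolding F_def using planar_layer_main[of r "n div 2" n] that by simp
  qed
  moreover have "F r \<subseteq> snd (kron (K_nnn n) K2)" for r
    unfolding F_def edges_eq by blast
  moreover have "snd (kron (K_nnn n) K2) \<subseteq> (\<Union>i<n div 2 + 1. F i)"
  proof
    fix e assume "e \<in> snd (kron (K_nnn n) K2)"
    then obtain q a b where e: "e = cyc_edge q a b" "q < 6" "a < n" "b < n"
      unfolding edges_eq by blast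
    have "b div 2 \<le> n div 2" using e(4) by (intro div_le_mono) simp
    then have "layer (n div 2) a b < n div 2 + 1"
      unfolding layer_def by simp
    with e show "e \<in> (\<Union>i<n div 2 + 1. F i)"
      unfolding F_def by blast
  qed
  ultimately show ?thesis by (intro exI[of _ F]) blast
qed

theorem theorem4p6:
  fixes n :: nat
  assumes "n \<ge> 1"
  shows "thickness (kron (K_nnn n) K2) = nat \<lceil>real (n + 1) / 2\<rceil>"
proof -
  have "thickness (kron (K_nnn n) K2) = n div 2 + 1"
    unfolding thickness_def
  proof (rule Least_equality)
    fix k :: nat
    assume "\<exists>F. (\<forall>i<k. F i \<subseteq> snd (kron (K_nnn n) K2) \<and> planar (fst (kron (K_nnn n) K2), F i)) \<and>
      (\<Union>i<k. F i) = snd (kron (K_nnn n) K2)"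
    then show "n div 2 + 1 \<le> k"
      using thickness_lower[OF assms] by (elim exE conjE)
  qed (rule thickness_upper)
  moreover have "\<lceil>real (n + 1) / 2\<rceil> = int (n div 2 + 1)"
  proof (rule ceiling_unique)
    define d where "d = n div 2"
    have "n = 2 * d \<or> n = 2 * d + 1"
      unfolding d_def by presburger
    then have "real n = 2 * real d \<or> real n = 2 * real d + 1"
      by auto
    then show "of_int (int (n div 2 + 1)) - 1 < real (n + 1) / 2"
      "real (n + 1) / 2 \<le> of_int (int (n div 2 + 1))"
      unfolding d_def[symmetric] by auto
  qed
  ultimately show ?thesis by simp
qed

end
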